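(* Let $X$ be a finite simplicial complex with a free simplicial involution $A:X\to X$, and let $n$ be a positive integer. Then the following statements are equivalent: (1) For any continuous mapping $f:X\to\mathbb R^n$ there is $x\in X$ such that $f(A(x))=f(x)$ (i.e. $(X,A)$ is a $\mathrm{BUT}_n$-space). (2) For any antipodal triangulation $\mathcal T$ of $X$ and any antipodal labeling $L:V(\mathcal T)\to\{+1,-1,+2,-2,\ldots,+n,-n\}$ there exists a complementary edge in $\mathcal T$. (3) For any positive integer $m$, any antipodal triangulation $\mathcal T$ of $X$ and any antipodal labeling $L:V(\mathcal T)\to\{+1,-1,+2,-2,\ldots,+m,-m\}$ without complementary edges, there is an $n$-simplex in $\mathcal T$ with labels of the form $\{k_0,-k_1,k_2,\ldots,(-1)^nk_n\}$, where $1\le k_0<k_1<\cdots<k_n\le m$. (4) For any positive integer $m$, any centrally symmetric set of $2m$ points $\{p_1,p_{-1},\ldots,p_m,p_{-m}\}$, $p_{-k}=-p_k$, in $\mathbb R^n$, any antipodal triangulation $\mathcal T$ of $X$, and any antipodal labeling $L:V(\mathcal T)\to\{+1,-1,+2,-2,\ldots,+m,-m\}$, there exists a $k$-simplex in $\mathcal T$ (for some $k$) with labels $\ell_0,\ldots,\ell_k$ such that the convex hull of the points $\{p_{\ell_0},\ldots,p_{\ell_k}\}\subset\mathbb R^n$ contains the origin $0$ of $\mathbb R^n$.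
   Context: An antipodal (equivariant) triangulation $\mathcal T$ of $X$ is a triangulation such that for any simplex $s$ of $\mathcal T$ the image $A(s)$ is also a simplex of $\mathcal T$ and $s\cap A(s)=\emptyset$. $V(\mathcal T)$ denotes the vertex set of $\mathcal T$; $A$ induces a free involution on $V(\mathcal T)$. A labeling $L:V(\mathcal T)\to\{\pm1,\ldots,\pm m\}$ is antipodal if $L(A(v))=-L(v)$ for every vertex $v\in V(\mathcal T)$. An edge $[u,v]$ of $\mathcal T$ is complementary if $L(u)=-L(v)$. *)

theory Defs
  imports "HOL-Analysis.Analysis"
begin

definition simplicial_self_map :: "'a::euclidean_space set set \<Rightarrow> ('a \<Rightarrow> 'a) \<Rightarrow> bool" where
  "simplicial_self_map K A \<longleftrightarrow>
     (\<forall>S\<in>K. A ` S \<in> K \<and>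
        (\<forall>x\<in>S. \<forall>y\<in>S. \<forall>u\<in>{0..1}.
           A ((1 - u) *\<^sub>R x + u *\<^sub>R y) = (1 - u) *\<^sub>R A x + u *\<^sub>R A y))"

definition free_involution_on :: "'a set \<Rightarrow> ('a \<Rightarrow> 'a) \<Rightarrow> bool" where
  "free_involution_on X A \<longleftrightarrow> (\<forall>x\<in>X. A x \<in> X \<and> A (A x) = x \<and> A x \<noteq> x)"

definition abstract_complex :: "'v set set \<Rightarrow> bool" where
  "abstract_complex \<Delta> \<longleftrightarrow> finite \<Delta> \<and> (\<forall>\<sigma>\<in>\<Delta>. finite \<sigma> \<and> \<sigma> \<noteq> {}) \<and>
     (\<forall>\<sigma>\<in>\<Delta>. \<forall>\<tau>. \<tau> \<subseteq> \<sigma> \<and> \<tau> \<noteq> {} \<longrightarrow> \<tau> \<in> \<Delta>)"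

text \<open>Points of the geometric realization are given by their barycentric coordinates. As the
  complexes are finite, the product topology on functions induces the usual topology on the
  realization.\<close>

definition bary_simplex :: "'v set \<Rightarrow> ('v \<Rightarrow> real) set" where
  "bary_simplex \<sigma> = {t. (\<forall>v. 0 \<le> t v) \<and> (\<forall>v. v \<notin> \<sigma> \<longrightarrow> t v = 0) \<and> sum t \<sigma> = 1}"

definition realization :: "'v set set \<Rightarrow> ('v \<Rightarrow> real) set" where
  "realization \<Delta> = (\<Union>\<sigma>\<in>\<Delta>. bary_simplex \<sigma>)"

text \<open>A triangulation of a (compact) space \<open>X\<close> is a finite simplicial complex together with a
  homeomorphism \<open>h\<close> from its realization onto \<open>X\<close>. The vertices are named by the points of \<open>X\<close>
  they correspond to under \<open>h\<close>, so that \<open>V(T) \<subseteq> X\<close>; this is no loss of generality.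
  The simplices, as subsets of \<open>X\<close>, are the images \<open>carrier_simplex h \<sigma>\<close>.\<close>

definition triangulation_of ::
    "'a::topological_space set \<Rightarrow> 'a set set \<Rightarrow> (('a \<Rightarrow> real) \<Rightarrow> 'a) \<Rightarrow> bool" where
  "triangulation_of X \<Delta> h \<longleftrightarrow> abstract_complex \<Delta> \<and>
     (\<exists>g. homeomorphism (realization \<Delta>) X h g) \<and>
     (\<forall>v\<in>\<Union>\<Delta>. h (indicat_real {v}) = v)"

definition carrier_simplex :: "(('a \<Rightarrow> real) \<Rightarrow> 'a) \<Rightarrow> 'a set \<Rightarrow> 'a set" where
  "carrier_simplex h \<sigma> = h ` bary_simplex \<sigma>"

definition antipodal_triangulation ::
    "'a::topological_space set \<Rightarrow> ('a \<Rightarrow> 'a) \<Rightarrow> 'a set set \<Rightarrow> (('a \<Rightarrow> real) \<Rightarrow> 'a) \<Rightarrow> bool" where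
  "antipodal_triangulation X A \<Delta> h \<longleftrightarrow> triangulation_of X \<Delta> h \<and>
     (\<forall>\<sigma>\<in>\<Delta>. (\<exists>\<tau>\<in>\<Delta>. A ` carrier_simplex h \<sigma> = carrier_simplex h \<tau>) \<and>
             carrier_simplex h \<sigma> \<inter> A ` carrier_simplex h \<sigma> = {})"

definition labels :: "nat \<Rightarrow> int set" where
  "labels m = {l. 1 \<le> \<bar>l\<bar> \<and> \<bar>l\<bar> \<le> int m}"

definition antipodal_labeling ::
    "('a \<Rightarrow> 'a) \<Rightarrow> 'a set set \<Rightarrow> nat \<Rightarrow> ('a \<Rightarrow> int) \<Rightarrow> bool" where
  "antipodal_labeling A \<Delta> m L \<longleftrightarrow> (\<forall>v\<in>\<Union>\<Delta>. L v \<in> labels m \<and> L (A v) = - L v)"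

definition complementary_edge :: "'a set set \<Rightarrow> ('a \<Rightarrow> int) \<Rightarrow> 'a \<Rightarrow> 'a \<Rightarrow> bool" where
  "complementary_edge \<Delta> L u v \<longleftrightarrow> u \<noteq> v \<and> {u, v} \<in> \<Delta> \<and> L u = - L v"

end

theory Submission
  imports Defs
begin

text \<open>
  The cycle (1), (4), (3), (2), (1). For (1) to (4), extend the vertex map \<open>p \<circ> L\<close> affinely over
  the simplices of the triangulation and pull it back to \<open>f\<close> on \<open>X\<close>. Although \<open>A\<close> need not be
  affine with respect to the triangulation, a coincidence \<open>f (A x) = f x\<close> with \<open>x\<close> in \<open>\<sigma>\<close> is a
  point of \<open>C \<inter> - C\<close>, where \<open>C\<close> is the hull of the points \<open>p (L v)\<close>, \<open>v \<in> \<sigma>\<close>, so \<open>0 \<in> C\<close>.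
  For (4) to (3), put the \<open>p k\<close> on the moment curve: a linear relation between such points has
  at least \<open>n\<close> sign changes, since otherwise a polynomial of degree less than \<open>n\<close> has the
  signs of its coefficients. (3) to (2) is the pigeonhole principle. For (2) to (1), a map
  without coincidences makes \<open>g x = f x - f (A x)\<close> odd and bounded away from zero; labelling the
  vertices of an \<open>A\<close>-invariant iterated barycentric subdivision of small mesh by a large
  coordinate of \<open>g\<close> and its sign leaves no complementary edge.
\<close>

section \<open>Flags and sign changes\<close>

text \<open>Statements (2) to (4) range over all topological triangulations, whose cells may be
  curved and on which \<open>A\<close> need not be affine. An argument about an arbitrary one may
  therefore use only which simplex carries a point and how \<open>A\<close> permutes the vertices.
  To exploit (2), by contrast, one fine triangulation is enough, and it can be chosen with straight
  simplices inside those of \<open>K\<close>, where \<open>A\<close> is affine and commutes with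
  barycenters. The main labour is to show that subdividing is legitimate: the subdivided complex
  must be embedded and must fill the same set. Both follow from one fact: nonnegative coordinates on
  a simplex and nonnegative weights on a flag of its faces determine each other. The points
  \<open>p\<close> in (4) may be chosen freely; the moment curve turns a linear relation among them
  into a condition on all polynomials of low degree. The resulting alternation of signs may begin
  with either sign, and \<open>A\<close> exchanges the two cases.\<close>

text \<open>Barycentric coordinates of the point with weight \<open>s \<sigma>\<close> at the
  barycenter of each face \<open>\<sigma>\<close> in \<open>C\<close>: a barycenter spreads its
  weight evenly over the vertices of its face.\<close>

definition flag_coords :: "'v set set \<Rightarrow> ('v set \<Rightarrow> real) \<Rightarrow> 'v \<Rightarrow> real" where
  "flag_coords C s v = (\<Sum>\<sigma>\<in>C. if v \<in> \<sigma> then s \<sigma> / real (card \<sigma>) else 0)"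

lemma finite_chain_greatest:
  assumes "chain\<^sub>\<subseteq> C" "finite C" "C \<noteq> {}"
  obtains M where "M \<in> C" "\<And>\<sigma>. \<sigma> \<in> C \<Longrightarrow> \<sigma> \<subseteq> M"
proof -
  obtain M where "M \<in> C" "\<forall>\<sigma>\<in>C. M \<subseteq> \<sigma> \<longrightarrow> M = \<sigma>"
    using finite_has_maximal[OF assms(2,3)] by blast
  with that assms(1) show thesis unfolding chain_subset_def by (metis order_refl)
qed

lemma finite_chain_least:
  assumes "chain\<^sub>\<subseteq> C" "finite C" "C \<noteq> {}"
  obtains M where "M \<in> C" "\<And>\<sigma>. \<sigma> \<in> C \<Longrightarrow> M \<subseteq> \<sigma>"
proof -
  obtain M where "M \<in> C" "\<forall>\<sigma>\<in>C. \<sigma> \<subseteq> M \<longrightarrow> M = \<sigma>"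
    using finite_has_minimal[OF assms(2,3)] by blast
  with that assms(1) show thesis unfolding chain_subset_def by (metis order_refl)
qed

text \<open>The weight of \<open>\<sigma>\<close> is proportional to the gap between the least coordinate on \<open>\<sigma>\<close> and
  the greatest coordinate off \<open>\<sigma>\<close>.\<close>

lemma flag_coords_recover:
  fixes s :: "'v set \<Rightarrow> real"
  assumes C: "chain\<^sub>\<subseteq> C" "finite C" and V: "finite V" "\<Union>C \<subseteq> V"
    and nn: "\<And>\<rho>. \<rho> \<in> C \<Longrightarrow> 0 \<le> s \<rho>"
    and \<sigma>: "\<sigma> \<subseteq> V" "\<sigma> \<noteq> {}" and off: "\<sigma> \<notin> C \<Longrightarrow> s \<sigma> = 0"
  shows "s \<sigma> = real (card \<sigma>) *
    max 0 (Min (flag_coords C s ` \<sigma>) - Max (insert 0 (flag_coords C s ` (V - \<sigma>))))"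
proof -
  define x where "x = flag_coords C s"
  define D where "D = {\<rho>\<in>C. \<rho> \<subset> \<sigma>}"
  define U where "U = {\<rho>\<in>C. \<not> \<rho> \<subseteq> \<sigma>}"
  define u where "u = (\<Sum>\<rho>\<in>U. s \<rho> / real (card \<rho>))"
  define a where "a = (if \<sigma> \<in> C then s \<sigma> / real (card \<sigma>) else 0)"
  have fin\<sigma>: "finite \<sigma>" using V \<sigma> finite_subset by blast
  have fD: "finite D" and fU: "finite U" using C by (auto simp: D_def U_def)
  have cD: "chain\<^sub>\<subseteq> D" and cU: "chain\<^sub>\<subseteq> U" using C(1) by (auto simp: D_def U_def chain_subset_def)
  have w0: "0 \<le> s \<rho> / real (card \<rho>)" if "\<rho> \<in> C" for \<rho> using nn[OF that] by simp
  have u0: "0 \<le> u" unfolding u_def by (intro sum_nonneg w0) (auto simp: U_def)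
  have a0: "0 \<le> a" unfolding a_def using w0 by auto
  have split: "(\<Sum>\<rho>\<in>C. f \<rho>) = sum f U + sum f D + (if \<sigma> \<in> C then f \<sigma> else 0)" for f :: "'v set \<Rightarrow> real"
  proof -
    have "C = U \<union> (D \<union> (C \<inter> {\<sigma>}))" by (auto simp: U_def D_def)
    moreover have "sum f (U \<union> (D \<union> (C \<inter> {\<sigma>}))) = sum f U + sum f (D \<union> (C \<inter> {\<sigma>}))"
      by (intro sum.union_disjoint) (use fU fD in \<open>auto simp: U_def D_def\<close>)
    moreover have "sum f (D \<union> (C \<inter> {\<sigma>})) = sum f D + sum f (C \<inter> {\<sigma>})"
      by (intro sum.union_disjoint) (use fU fD in \<open>auto simp: U_def D_def\<close>)
    moreover have "sum f (C \<inter> {\<sigma>}) = (if \<sigma> \<in> C then f \<sigma> else 0)" by auto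
    ultimately show ?thesis by simp
  qed
  \<comment> \<open>A vertex of \<open>\<sigma>\<close> missed by all smaller members of the flag:
    its coordinate receives nothing from them, hence is at most \<open>u + a\<close>.\<close>
  obtain v where v: "v \<in> \<sigma>" "\<And>\<rho>. \<rho> \<in> D \<Longrightarrow> v \<notin> \<rho>"
  proof (cases "D = {}")
    case True then show ?thesis using that \<sigma> by auto
  next
    case False
    then obtain M where M: "M \<in> D" "\<And>\<rho>. \<rho> \<in> D \<Longrightarrow> \<rho> \<subseteq> M" using finite_chain_greatest[OF cD fD] by metis
    then obtain v where "v \<in> \<sigma> - M" by (auto simp: D_def)
    then show ?thesis using that M(2) by blast
  qed
  have xv: "x v \<le> u + a"
  proof -
    have "sum (\<lambda>\<rho>. if v \<in> \<rho> then s \<rho> / real (card \<rho>) else 0) U \<le> u"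
      unfolding u_def by (intro sum_mono) (auto simp: U_def intro: w0)
    moreover have "sum (\<lambda>\<rho>. if v \<in> \<rho> then s \<rho> / real (card \<rho>) else 0) D = 0"
      by (intro sum.neutral) (use v in auto)
    ultimately show ?thesis unfolding x_def flag_coords_def split using v by (auto simp: a_def)
  qed
  have xge: "u + a \<le> x w" if "w \<in> \<sigma>" "\<sigma> \<in> C" for w
  proof -
    have "sum (\<lambda>\<rho>. if w \<in> \<rho> then s \<rho> / real (card \<rho>) else 0) U = u"
      unfolding u_def by (intro sum.cong) (use that C(1) in \<open>auto simp: U_def chain_subset_def\<close>)
    moreover have "sum (\<lambda>\<rho>. if w \<in> \<rho> then s \<rho> / real (card \<rho>) else 0) D \<ge> 0"
      by (intro sum_nonneg) (auto simp: D_def intro: w0)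
    ultimately show ?thesis unfolding x_def flag_coords_def split using that by (auto simp: a_def)
  qed
  have xle: "x w \<le> u" if "w \<notin> \<sigma>" for w
  proof -
    have "sum (\<lambda>\<rho>. if w \<in> \<rho> then s \<rho> / real (card \<rho>) else 0) U \<le> u"
      unfolding u_def by (intro sum_mono) (auto simp: U_def intro: w0)
    moreover have "sum (\<lambda>\<rho>. if w \<in> \<rho> then s \<rho> / real (card \<rho>) else 0) D = 0"
      by (intro sum.neutral) (use that in \<open>auto simp: D_def\<close>)
    ultimately show ?thesis unfolding x_def flag_coords_def split using that by auto
  qed
  \<comment> \<open>The bound \<open>u\<close> is attained. If every member of the flag lies in
    \<open>\<sigma>\<close>, it is 0, which is why 0 is inserted under \<open>Max\<close>; otherwise
    the least member not inside \<open>\<sigma>\<close> has a vertex off \<open>\<sigma>\<close>,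
    and this vertex lies in all such members.\<close>
  have att: "u \<in> insert 0 (x ` (V - \<sigma>))"
  proof (cases "U = {}")
    case True then show ?thesis by (simp add: u_def)
  next
    case False
    then obtain M where M: "M \<in> U" "\<And>\<rho>. \<rho> \<in> U \<Longrightarrow> M \<subseteq> \<rho>" using finite_chain_least[OF cU fU] by metis
    then obtain w where w: "w \<in> M - \<sigma>" by (auto simp: U_def)
    have "sum (\<lambda>\<rho>. if w \<in> \<rho> then s \<rho> / real (card \<rho>) else 0) U = u"
      unfolding u_def by (intro sum.cong) (use M w in auto)
    moreover have "sum (\<lambda>\<rho>. if w \<in> \<rho> then s \<rho> / real (card \<rho>) else 0) D = 0"
      by (intro sum.neutral) (use w in \<open>auto simp: D_def\<close>)
    ultimately have "x w = u" unfolding x_def flag_coords_def split using w by auto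
    moreover have "w \<in> V" using w M V by (auto simp: U_def)
    ultimately show ?thesis using w by auto
  qed
  have mx: "Max (insert 0 (x ` (V - \<sigma>))) = u"
    by (rule Max_eqI) (use att V u0 xle in auto)
  show ?thesis
  proof (cases "\<sigma> \<in> C")
    case True
    have "x v = u + a" using xv xge[OF v(1) True] by linarith
    then have "Min (x ` \<sigma>) = u + a"
      by (intro Min_eqI) (use fin\<sigma> v xge True in \<open>auto intro!: image_eqI[of _ _ v]\<close>)
    then show ?thesis using mx True a0 fin\<sigma> \<sigma> by (simp add: x_def[symmetric] a_def)
  next
    case False
    \<comment> \<open>Off the flag \<open>a\<close> is 0, so the gap is at most 0 and
      \<open>max 0\<close> returns the correct weight 0.\<close>
    have "Min (x ` \<sigma>) \<le> x v" using v fin\<sigma> by (intro Min_le) auto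
    then show ?thesis using mx False xv off by (simp add: x_def[symmetric] a_def)
  qed
qed

text \<open>Subtract the least coordinate \<open>c\<close> on the whole support \<open>S\<close>. At
  least one coordinate becomes 0, so the rest has smaller support and yields a flag strictly below
  \<open>S\<close> by induction; \<open>S\<close> is added on top with weight
  \<open>c * card S\<close>, where the factor cancels the division in
  \<open>flag_coords\<close>.\<close>

lemma flag_coords_exists:
  fixes x :: "'v \<Rightarrow> real"
  assumes "finite S" "\<And>v. v \<in> S \<Longrightarrow> 0 < x v" "\<And>v. v \<notin> S \<Longrightarrow> x v = 0"
  shows "\<exists>C s. chain\<^sub>\<subseteq> C \<and> C \<subseteq> Pow S - {{}} \<and> (\<forall>\<sigma>. 0 \<le> s \<sigma>) \<and> (\<forall>\<sigma>. \<sigma> \<notin> C \<longrightarrow> s \<sigma> = 0) \<and>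
    x = flag_coords C s"
  using assms
proof (induction "card S" arbitrary: S x rule: less_induct)
  case less
  show ?case
  proof (cases "S = {}")
    case True
    then have "chain\<^sub>\<subseteq> {} \<and> {} \<subseteq> Pow S - {{}} \<and> x = flag_coords {} (\<lambda>_. 0)"
      using less.prems by (auto simp: chain_subset_def flag_coords_def fun_eq_iff)
    then show ?thesis
      by (intro exI[of _ "{}"] exI[of _ "\<lambda>_. 0"]) auto
  next
    case False
    define c where "c = Min (x ` S)"
    define y where "y = (\<lambda>v. if v \<in> S then x v - c else 0)"
    define T where "T = {v\<in>S. 0 < y v}"
    have c: "c \<in> x ` S" "\<And>v. v \<in> S \<Longrightarrow> c \<le> x v"
      using False less.prems(1) by (auto simp: c_def)
    have c0: "c > 0" using c(1) less.prems by auto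
    have TS: "T \<subset> S" using c(1) by (auto simp: T_def y_def)
    have "card T < card S" using TS less.prems by (simp add: psubset_card_mono)
    moreover have "finite T" using TS less.prems finite_subset by blast
    moreover have "\<And>v. v \<in> T \<Longrightarrow> 0 < y v" by (simp add: T_def)
    moreover have "\<And>v. v \<notin> T \<Longrightarrow> y v = 0" using c by (force simp: T_def y_def)
    ultimately obtain C s where C: "chain\<^sub>\<subseteq> C" "C \<subseteq> Pow T - {{}}" "\<forall>\<sigma>. 0 \<le> s \<sigma>"
      "\<forall>\<sigma>. \<sigma> \<notin> C \<longrightarrow> s \<sigma> = 0" "y = flag_coords C s"
      using less.hyps[of T y] by blast
    have fC: "finite C" using C(2) \<open>finite T\<close> finite_subset by blast
    have SC: "S \<notin> C" using C(2) TS by auto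
    let ?s = "s(S := c * real (card S))"
    have "x v = flag_coords (insert S C) ?s v" for v
    proof -
      have "flag_coords (insert S C) ?s v = (if v \<in> S then c else 0) + flag_coords C s v"
        unfolding flag_coords_def sum.insert[OF fC SC]
        by (intro arg_cong2[where f="(+)"] sum.cong)
          (use SC False less.prems(1) in \<open>auto simp: fun_upd_def\<close>)
      then show ?thesis using less.prems(3)[of v] by (simp add: C(5)[symmetric] y_def)
    qed
    moreover have "chain\<^sub>\<subseteq> (insert S C)" using C(1,2) TS by (auto simp: chain_subset_def)
    moreover have "insert S C \<subseteq> Pow S - {{}}" using C(2) TS False by auto
    ultimately show ?thesis using C(3,4) c0
      by (intro exI[of _ "insert S C"] exI[of _ ?s]) (auto simp: fun_eq_iff)
  qed
qed

lemma sum_flag_coords: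
  assumes "finite C" "finite S" "\<And>\<sigma>. \<sigma> \<in> C \<Longrightarrow> \<sigma> \<subseteq> S \<and> \<sigma> \<noteq> {}"
  shows "sum (flag_coords C s) S = sum s C"
proof -
  have "sum (flag_coords C s) S = (\<Sum>\<sigma>\<in>C. \<Sum>v\<in>S. if v \<in> \<sigma> then s \<sigma> / real (card \<sigma>) else 0)"
    unfolding flag_coords_def by (rule sum.swap)
  also have "\<dots> = sum s C"
  proof (rule sum.cong[OF refl])
    fix \<sigma> assume "\<sigma> \<in> C"
    then have "\<sigma> \<subseteq> S" "\<sigma> \<noteq> {}" using assms by auto
    then have "(\<Sum>v\<in>S. if v \<in> \<sigma> then s \<sigma> / real (card \<sigma>) else 0) = (\<Sum>v\<in>\<sigma>. s \<sigma> / real (card \<sigma>))"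
      using assms(2) by (simp add: sum.If_cases Int_absorb1)
    also have "\<dots> = s \<sigma>" using \<open>\<sigma> \<noteq> {}\<close> finite_subset[OF \<open>\<sigma> \<subseteq> S\<close> assms(2)] by simp
    finally show "(\<Sum>v\<in>S. if v \<in> \<sigma> then s \<sigma> / real (card \<sigma>) else 0) = s \<sigma>" .
  qed
  finally show ?thesis .
qed

section \<open>Sign changes and polynomials\<close>

text \<open>One number \<open>d\<close> serves as the length of an alternating sequence and as a
  degree bound. Going upwards through \<open>N\<close>, a repeated sign changes nothing, while a new
  sign prolongs the sequence and costs \<open>q\<close> one more root. The conjuncts on
  \<open>k d\<close> and on the sign of \<open>q\<close> from \<open>Max N\<close> onwards are there
  to carry the induction.\<close>

lemma alternating_or_polynomial:
  fixes N :: "nat set" and s :: "nat \<Rightarrow> real"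
  assumes "finite N" "N \<noteq> {}" "\<And>x. x \<in> N \<Longrightarrow> s x = 1 \<or> s x = -1"
  shows "\<exists>d k (q::real poly). strict_mono_on {0..d} k \<and> k ` {0..d} \<subseteq> N \<and>
     (\<forall>i\<le>d. s (k i) = (-1) ^ i * s (k 0)) \<and> s (k d) = s (Max N) \<and> degree q \<le> d \<and>
     (\<forall>x\<in>N. poly q (real x) * s x > 0) \<and> (\<forall>y. real (Max N) \<le> y \<longrightarrow> poly q y * s (Max N) > 0)"
  using assms
proof (induction N rule: finite_linorder_max_induct)
  case empty
  then show ?case by simp
next
  case (insert b N)
  have sb: "s b = 1 \<or> s b = -1" using insert.prems by auto
  have mb: "Max (insert b N) = b" using insert.hyps by (intro Max_eqI) (auto intro: less_imp_le)
  show ?case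
  proof (cases "N = {}")
    case True
    have "poly [:s b:] y * s b > 0" for y using sb by auto
    then show ?thesis using True
      by (intro exI[of _ 0] exI[of _ "\<lambda>_. b"] exI[of _ "[:s b:]"]) (auto simp: strict_mono_on_def)
  next
    case False
    define M where "M = Max N"
    have MN: "M \<in> N" "M < b" using False insert.hyps by (auto simp: M_def)
    obtain d k and q :: "real poly" where ih: "strict_mono_on {0..d} k" "k ` {0..d} \<subseteq> N"
       "\<forall>i\<le>d. s (k i) = (-1) ^ i * s (k 0)" "s (k d) = s M" "degree q \<le> d"
       "\<forall>x\<in>N. poly q (real x) * s x > 0" "\<forall>y. real M \<le> y \<longrightarrow> poly q y * s M > 0"
      using insert.IH insert.prems False unfolding M_def by blast
    show ?thesis
    proof (cases "s b = s M")
      case True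
      have pos: "poly q y * s b > 0" if "real b \<le> y" for y
        using ih(7) that MN True by simp
      have "\<forall>x\<in>insert b N. poly q (real x) * s x > 0"
        using ih(6) pos by blast
      moreover have "k ` {0..d} \<subseteq> insert b N" using ih(2) by blast
      ultimately show ?thesis unfolding mb True
        using ih(1,3,4,5) pos[unfolded True] by blast
    next
      case False
      then have sbM: "s b = - s M" using sb insert.prems(2)[of M] MN(1) by auto
      \<comment> \<open>The new root lies strictly between the old maximum and \<open>b\<close>, so
        the factor \<open>r - y\<close> keeps all signs on \<open>N\<close> and flips them from
        \<open>b\<close> onwards.\<close>
      define r where "r = (real M + real b) / 2"
      define q' where "q' = q * [:r, -1:]"
      define k' where "k' = k(Suc d := b)"
      have pq': "poly q' y = poly q y * (r - y)" for y by (simp add: q'_def algebra_simps)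
      have r: "real M < r" "r < real b" using MN by (auto simp: r_def)
      have kd: "k i < b" if "i \<le> d" for i using ih(2) insert.hyps(2) that by (auto simp: image_subset_iff)
      have "strict_mono_on {0..Suc d} k'"
        using ih(1) kd by (auto simp: strict_mono_on_def k'_def)
      moreover have "k' ` {0..Suc d} \<subseteq> insert b N" using ih(2) by (auto simp: k'_def image_subset_iff)
      moreover have "\<forall>i\<le>Suc d. s (k' i) = (-1) ^ i * s (k' 0)"
      proof (intro allI impI)
        fix i assume "i \<le> Suc d"
        then consider "i \<le> d" | "i = Suc d" by linarith
        then show "s (k' i) = (-1) ^ i * s (k' 0)"
        proof cases
          case 2
          have "s (k d) = (-1) ^ d * s (k 0)" using ih(3) by blast
          with 2 sbM ih(4) show ?thesis by (simp add: k'_def)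
        next
          case 1
          then have "s (k i) = (-1) ^ i * s (k 0)" using ih(3) by blast
          with 1 show ?thesis by (simp add: k'_def)
        qed
      qed
      moreover have "s (k' (Suc d)) = s b" by (simp add: k'_def)
      moreover have "degree q' \<le> Suc d"
        using degree_mult_le[of q "[:r, -1:]"] ih(5) by (simp add: q'_def)
      moreover have big: "poly q' y * s b > 0" if "real b \<le> y" for y
      proof -
        have "poly q y * s M > 0" using ih(7) that MN by auto
        moreover have "y - r > 0" using that r by linarith
        ultimately have "(poly q y * s M) * (y - r) > 0" by simp
        then show ?thesis by (simp add: pq' sbM algebra_simps)
      qed
      moreover have "poly q' (real x) * s x > 0" if "x \<in> insert b N" for x
      proof (cases "x = b")
        case False
        then have "x \<in> N" using that by auto
        then have "x \<le> M" using insert.hyps by (simp add: M_def)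
        then have "r - real x > 0" using r by linarith
        moreover have "poly q (real x) * s x > 0" using ih(6) \<open>x \<in> N\<close> by blast
        ultimately have "(poly q (real x) * s x) * (r - real x) > 0" by simp
        then show ?thesis by (simp add: pq' algebra_simps)
      qed (use big in auto)
      ultimately show ?thesis unfolding mb
        by (intro exI[of _ "Suc d"] exI[of _ k'] exI[of _ q']) blast
    qed
  qed
qed

section \<open>Geometric complexes\<close>

text \<open>The sum runs over all vertices of the complex, so one formula serves every simplex and
  continuity needs no gluing.\<close>

definition affine_extension :: "'v set set \<Rightarrow> ('v \<Rightarrow> 'b::real_vector) \<Rightarrow> ('v \<Rightarrow> real) \<Rightarrow> 'b" where
  "affine_extension \<Delta> p t = (\<Sum>v\<in>\<Union>\<Delta>. t v *\<^sub>R p v)"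

text \<open>Injectivity on the realization says at once that each simplex has affinely independent
  vertices and that the simplices meet only in common faces.\<close>

definition geometric_complex :: "'a::real_vector set set \<Rightarrow> bool" where
  "geometric_complex \<Delta> \<longleftrightarrow>
     abstract_complex \<Delta> \<and> inj_on (affine_extension \<Delta> (\<lambda>v. v)) (realization \<Delta>)"

definition polyhedron_of :: "'a::real_vector set set \<Rightarrow> 'a set" where
  "polyhedron_of \<Delta> = (\<Union>\<sigma>\<in>\<Delta>. convex hull \<sigma>)"

lemma abstract_complexD:
  assumes "abstract_complex \<Delta>"
  shows "finite \<Delta>" "finite (\<Union>\<Delta>)" "\<sigma> \<in> \<Delta> \<Longrightarrow> finite \<sigma>" "\<sigma> \<in> \<Delta> \<Longrightarrow> \<sigma> \<noteq> {}"
    "\<sigma> \<in> \<Delta> \<Longrightarrow> \<tau> \<subseteq> \<sigma> \<Longrightarrow> \<tau> \<noteq> {} \<Longrightarrow> \<tau> \<in> \<Delta>" "v \<in> \<Union>\<Delta> \<Longrightarrow> {v} \<in> \<Delta>"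
proof -
  show fin: "finite \<Delta>" "\<sigma> \<in> \<Delta> \<Longrightarrow> finite \<sigma>" for \<sigma>
    using assms by (auto simp: abstract_complex_def)
  then show "finite (\<Union>\<Delta>)" by blast
  show "\<sigma> \<in> \<Delta> \<Longrightarrow> \<sigma> \<noteq> {}" using assms by (auto simp: abstract_complex_def)
  show face: "\<sigma> \<in> \<Delta> \<Longrightarrow> \<tau> \<subseteq> \<sigma> \<Longrightarrow> \<tau> \<noteq> {} \<Longrightarrow> \<tau> \<in> \<Delta>" for \<sigma> \<tau>
    using assms unfolding abstract_complex_def by blast
  show "v \<in> \<Union>\<Delta> \<Longrightarrow> {v} \<in> \<Delta>" using face[of _ "{v}"] by blast
qed

lemma affine_extension_simplex:
  assumes "abstract_complex \<Delta>" "\<sigma> \<in> \<Delta>" "t \<in> bary_simplex \<sigma>"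
  shows "affine_extension \<Delta> p t = (\<Sum>v\<in>\<sigma>. t v *\<^sub>R p v)"
  unfolding affine_extension_def
  using assms abstract_complexD[OF assms(1)]
  by (intro sum.mono_neutral_right) (auto simp: bary_simplex_def)

lemma affine_extension_in_hull:
  assumes "abstract_complex \<Delta>" "\<sigma> \<in> \<Delta>" "t \<in> bary_simplex \<sigma>"
  shows "affine_extension \<Delta> p t \<in> convex hull (p ` \<sigma>)"
  unfolding affine_extension_simplex[OF assms]
  using assms abstract_complexD[OF assms(1)]
  by (intro convex_sum convex_convex_hull) (auto simp: bary_simplex_def intro: hull_inc)

lemma affine_extension_image:
  assumes "abstract_complex \<Delta>" "\<sigma> \<in> \<Delta>"
  shows "affine_extension \<Delta> (\<lambda>v. v) ` bary_simplex \<sigma> = convex hull \<sigma>"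
proof
  show "affine_extension \<Delta> (\<lambda>v. v) ` bary_simplex \<sigma> \<subseteq> convex hull \<sigma>"
    using affine_extension_in_hull[OF assms, of _ "\<lambda>v. v"] by auto
  show "convex hull \<sigma> \<subseteq> affine_extension \<Delta> (\<lambda>v. v) ` bary_simplex \<sigma>"
  proof
    fix y assume "y \<in> convex hull \<sigma>"
    then obtain u where u: "\<forall>x\<in>\<sigma>. 0 \<le> u x" "sum u \<sigma> = 1" "(\<Sum>x\<in>\<sigma>. u x *\<^sub>R x) = y"
      using convex_hull_finite[of \<sigma>] abstract_complexD(3)[OF assms] by auto
    define t where "t = (\<lambda>v. if v \<in> \<sigma> then u v else 0)"
    have "t \<in> bary_simplex \<sigma>" using u by (auto simp: t_def bary_simplex_def)
    moreover have "(\<Sum>x\<in>\<sigma>. t x *\<^sub>R x) = y" using u by (simp add: t_def)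
    ultimately show "y \<in> affine_extension \<Delta> (\<lambda>v. v) ` bary_simplex \<sigma>"
      using affine_extension_simplex[OF assms, of t "\<lambda>v. v"] by force
  qed
qed

lemma polyhedron_of_eq:
  "abstract_complex \<Delta> \<Longrightarrow> affine_extension \<Delta> (\<lambda>v. v) ` realization \<Delta> = polyhedron_of \<Delta>"
  unfolding realization_def polyhedron_of_def by (simp add: image_UN affine_extension_image)

lemma continuous_on_affine_extension:
  fixes p :: "'v \<Rightarrow> 'b::real_normed_vector"
  shows "continuous_on S (affine_extension \<Delta> p)"
  unfolding affine_extension_def
  by (intro continuous_intros continuous_on_subset[OF continuous_on_product_coordinates]) auto

text \<open>A closed subset of the cube of all functions into the unit interval, which is compact by
  Tychonoff even for an infinite vertex type.\<close>

lemma compact_bary_simplex: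
  assumes "finite \<sigma>"
  shows "compact (bary_simplex \<sigma>)"
proof -
  have "compact (\<Pi>\<^sub>E i\<in>(UNIV::'a set). {0..1::real})"
    using compactin_PiE[of "\<lambda>_. euclidean" UNIV "\<lambda>_. {0..1::real}"]
    by (simp add: euclidean_product_topology)
  moreover have "closed (bary_simplex \<sigma>)"
  proof -
    have "closed {t::'a\<Rightarrow>real. 0 \<le> t v}" for v
      by (intro closed_Collect_le continuous_intros) auto
    moreover have "closed {t::'a\<Rightarrow>real. v \<notin> \<sigma> \<longrightarrow> t v = 0}" for v
      by (cases "v \<in> \<sigma>") (auto intro!: closed_Collect_eq continuous_intros)
    moreover have "closed {t::'a\<Rightarrow>real. sum t \<sigma> = 1}"
      by (intro closed_Collect_eq continuous_intros) auto
    moreover have "bary_simplex \<sigma> = (\<Inter>v. {t. 0 \<le> t v}) \<inter> (\<Inter>v. {t. v \<notin> \<sigma> \<longrightarrow> t v = 0}) \<inter> {t. sum t \<sigma> = 1}"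
      by (auto simp: bary_simplex_def)
    ultimately show ?thesis by (simp add: closed_INT closed_Int)
  qed
  moreover have "bary_simplex \<sigma> \<subseteq> (\<Pi>\<^sub>E i\<in>(UNIV::'a set). {0..1::real})"
  proof
    fix t assume t: "t \<in> bary_simplex \<sigma>"
    have "t v \<le> 1" for v
      using t member_le_sum[of v \<sigma> t] assms by (cases "v \<in> \<sigma>") (auto simp: bary_simplex_def)
    then show "t \<in> (\<Pi>\<^sub>E i\<in>UNIV. {0..1})" using t by (auto simp: bary_simplex_def PiE_def)
  qed
  ultimately show ?thesis by (metis compact_Int_closed Int_absorb1)
qed

lemma compact_realization:
  assumes "abstract_complex \<Delta>"
  shows "compact (realization \<Delta>)"
  unfolding realization_def
  by (intro compact_UN compact_bary_simplex) (use abstract_complexD[OF assms] in auto)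

lemma indicator_in_bary_simplex:
  "finite \<sigma> \<Longrightarrow> indicat_real {v} \<in> bary_simplex \<sigma> \<longleftrightarrow> v \<in> \<sigma>"
  by (auto simp: bary_simplex_def indicator_def)

lemma bary_simplex_singleton: "bary_simplex {v} = {indicat_real {v}}"
  by (auto simp: bary_simplex_def indicator_def fun_eq_iff)

text \<open>A continuous injection on a compact space is a homeomorphism onto its image.\<close>

lemma triangulation_of_geometric_complex:
  fixes \<Delta> :: "'a::real_normed_vector set set"
  assumes "geometric_complex \<Delta>"
  shows "triangulation_of (polyhedron_of \<Delta>) \<Delta> (affine_extension \<Delta> (\<lambda>v. v))"
  unfolding triangulation_of_def
proof (intro conjI ballI)
  have ac: "abstract_complex \<Delta>" using assms by (simp add: geometric_complex_def)
  then show "abstract_complex \<Delta>" .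
  show "\<exists>g. homeomorphism (realization \<Delta>) (polyhedron_of \<Delta>) (affine_extension \<Delta> (\<lambda>v. v)) g"
    by (intro homeomorphism_compact compact_realization ac continuous_on_affine_extension polyhedron_of_eq)
      (use assms in \<open>simp add: geometric_complex_def\<close>)
  fix v assume "v \<in> \<Union>\<Delta>"
  then have "affine_extension \<Delta> (\<lambda>v. v) (indicat_real {v}) = (\<Sum>w\<in>{v}. indicat_real {v} w *\<^sub>R w)"
    by (intro affine_extension_simplex[OF ac] abstract_complexD(6)[OF ac])
      (auto simp: bary_simplex_singleton)
  then show "affine_extension \<Delta> (\<lambda>v. v) (indicat_real {v}) = v" by simp
qed

section \<open>Barycentric subdivision\<close>

definition barycenter :: "'a::real_vector set \<Rightarrow> 'a" where
  "barycenter \<sigma> = (1 / real (card \<sigma>)) *\<^sub>R \<Sum>\<sigma>"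

definition barycentric_subdivision :: "'a::real_vector set set \<Rightarrow> 'a set set" where
  "barycentric_subdivision \<Delta> = {barycenter ` C | C. C \<subseteq> \<Delta> \<and> C \<noteq> {} \<and> chain\<^sub>\<subseteq> C}"

lemma barycentric_subdivisionI:
  "C \<subseteq> \<Delta> \<Longrightarrow> C \<noteq> {} \<Longrightarrow> chain\<^sub>\<subseteq> C \<Longrightarrow> barycenter ` C \<in> barycentric_subdivision \<Delta>"
  unfolding barycentric_subdivision_def by blast

lemma barycenter_eq_sum: "barycenter \<sigma> = (\<Sum>v\<in>\<sigma>. (1 / real (card \<sigma>)) *\<^sub>R v)"
  by (simp add: barycenter_def scaleR_sum_right)

lemma barycenter_in_hull: "finite \<sigma> \<Longrightarrow> \<sigma> \<noteq> {} \<Longrightarrow> barycenter \<sigma> \<in> convex hull \<sigma>"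
  unfolding barycenter_eq_sum
  by (intro convex_sum convex_convex_hull) (auto intro: hull_inc)

text \<open>The barycenter has uniform coordinates on \<open>\<sigma>\<close>, and their support is
  \<open>\<sigma>\<close> itself. Weights on faces can thus be treated as weights on the vertices of
  the subdivision.\<close>

lemma inj_on_barycenter:
  assumes "geometric_complex \<Delta>"
  shows "inj_on barycenter \<Delta>"
proof (rule inj_onI)
  have ac: "abstract_complex \<Delta>" using assms by (simp add: geometric_complex_def)
  define t where "t \<sigma> v = (if v \<in> \<sigma> then 1 / real (card \<sigma>) else 0)" for \<sigma> :: "'a set" and v
  have t: "t \<sigma> \<in> bary_simplex \<sigma>" "affine_extension \<Delta> (\<lambda>v. v) (t \<sigma>) = barycenter \<sigma>"
    if "\<sigma> \<in> \<Delta>" for \<sigma>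
  proof -
    show "t \<sigma> \<in> bary_simplex \<sigma>"
      using abstract_complexD(3,4)[OF ac that] by (auto simp: t_def bary_simplex_def)
    then show "affine_extension \<Delta> (\<lambda>v. v) (t \<sigma>) = barycenter \<sigma>"
      using affine_extension_simplex[OF ac that, of "t \<sigma>" "\<lambda>v. v"]
      by (simp add: t_def barycenter_eq_sum)
  qed
  fix \<sigma> \<tau> assume st: "\<sigma> \<in> \<Delta>" "\<tau> \<in> \<Delta>" "barycenter \<sigma> = barycenter \<tau>"
  then have "t \<sigma> = t \<tau>"
    using assms t[OF st(1)] t[OF st(2)] unfolding geometric_complex_def realization_def inj_on_def
    by (metis UN_I)
  moreover have "\<rho> = {v. t \<rho> v \<noteq> 0}" if "\<rho> \<in> \<Delta>" for \<rho>
    using abstract_complexD(3,4)[OF ac that] by (auto simp: t_def)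
  ultimately show "\<sigma> = \<tau>" using st by metis
qed

lemma finite_barycentric_subdivision:
  "finite \<Delta> \<Longrightarrow> finite (barycentric_subdivision \<Delta>)"
  by (rule finite_subset[of _ "(`) barycenter ` Pow \<Delta>"]) (auto simp: barycentric_subdivision_def)

lemma abstract_complex_barycentric_subdivision:
  assumes "abstract_complex \<Delta>"
  shows "abstract_complex (barycentric_subdivision \<Delta>)"
  unfolding abstract_complex_def
proof (intro conjI ballI allI impI)
  note D = abstract_complexD[OF assms]
  show "finite (barycentric_subdivision \<Delta>)" using D by (intro finite_barycentric_subdivision)
  fix S assume "S \<in> barycentric_subdivision \<Delta>"
  then obtain C where C: "S = barycenter ` C" "C \<subseteq> \<Delta>" "C \<noteq> {}" "chain\<^sub>\<subseteq> C"
    by (auto simp: barycentric_subdivision_def)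
  show "finite S" using C D(1) finite_subset by auto
  show "S \<noteq> {}" using C by auto
  fix T assume T: "T \<subseteq> S \<and> T \<noteq> {}"
  then obtain B where "B \<subseteq> C" "T = barycenter ` B" using C(1) subset_image_iff by metis
  moreover from this have "B \<subseteq> \<Delta>" "B \<noteq> {}" "chain\<^sub>\<subseteq> B"
    using C T unfolding chain_subset_def by blast+
  ultimately show "T \<in> barycentric_subdivision \<Delta>"
    using barycentric_subdivisionI by metis
qed

text \<open>The bridge between the two complexes: all faces of a flag lie in its greatest member
  \<open>M\<close>, so expanding the barycenters is a computation inside one simplex of
  \<open>\<Delta>\<close>.\<close>

lemma affine_extension_barycentric_subdivision:
  assumes "geometric_complex \<Delta>" "C \<subseteq> \<Delta>" "C \<noteq> {}" "chain\<^sub>\<subseteq> C" "t \<in> bary_simplex (barycenter ` C)"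
  shows "flag_coords C (t \<circ> barycenter) \<in> realization \<Delta>"
    "affine_extension (barycentric_subdivision \<Delta>) (\<lambda>v. v) t =
     affine_extension \<Delta> (\<lambda>v. v) (flag_coords C (t \<circ> barycenter))"
proof -
  have ac: "abstract_complex \<Delta>" using assms by (simp add: geometric_complex_def)
  note D = abstract_complexD[OF ac]
  have fC: "finite C" using assms D finite_subset by blast
  obtain M where M: "M \<in> C" "\<And>\<sigma>. \<sigma> \<in> C \<Longrightarrow> \<sigma> \<subseteq> M" using finite_chain_greatest[OF assms(4) fC assms(3)] by metis
  then have M\<Delta>: "M \<in> \<Delta>" using assms by auto
  let ?x = "flag_coords C (t \<circ> barycenter)"
  have inj: "inj_on barycenter C" using inj_on_barycenter[OF assms(1)] assms(2) inj_on_subset by blast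
  have xM: "?x \<in> bary_simplex M"
    unfolding bary_simplex_def
  proof (intro CollectI conjI allI impI)
    show "0 \<le> ?x v" for v unfolding flag_coords_def
      by (intro sum_nonneg) (use assms(5) in \<open>auto simp: bary_simplex_def\<close>)
    show "?x v = 0" if "v \<notin> M" for v unfolding flag_coords_def
      by (intro sum.neutral) (use M that in auto)
    have "sum ?x M = sum (t \<circ> barycenter) C"
      using M(2) D(4) assms(2) by (intro sum_flag_coords fC D(3)[OF M\<Delta>]) blast
    also have "\<dots> = sum t (barycenter ` C)" by (simp add: sum.reindex[OF inj])
    also have "\<dots> = 1" using assms(5) by (simp add: bary_simplex_def)
    finally show "sum ?x M = 1" .
  qed
  then show "?x \<in> realization \<Delta>" using M\<Delta> by (auto simp: realization_def)
  have "affine_extension (barycentric_subdivision \<Delta>) (\<lambda>v. v) t = (\<Sum>w\<in>barycenter ` C. t w *\<^sub>R w)"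
    using assms by (intro affine_extension_simplex abstract_complex_barycentric_subdivision[OF ac])
      (auto simp: barycentric_subdivision_def)
  also have "\<dots> = (\<Sum>\<sigma>\<in>C. t (barycenter \<sigma>) *\<^sub>R barycenter \<sigma>)"
    by (simp add: sum.reindex[OF inj])
  also have "\<dots> = (\<Sum>\<sigma>\<in>C. \<Sum>v\<in>M. (if v \<in> \<sigma> then t (barycenter \<sigma>) / real (card \<sigma>) else 0) *\<^sub>R v)"
  proof (rule sum.cong[OF refl])
    fix \<sigma> assume "\<sigma> \<in> C"
    then have "\<sigma> \<subseteq> M" using M by auto
    have "t (barycenter \<sigma>) *\<^sub>R barycenter \<sigma> = (\<Sum>v\<in>\<sigma>. (t (barycenter \<sigma>) / real (card \<sigma>)) *\<^sub>R v)"
      by (simp add: barycenter_def scaleR_sum_right)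
    also have "\<dots> = (\<Sum>v\<in>M. (if v \<in> \<sigma> then t (barycenter \<sigma>) / real (card \<sigma>) else 0) *\<^sub>R v)"
      using \<open>\<sigma> \<subseteq> M\<close> D(3)[OF M\<Delta>] by (intro sum.mono_neutral_cong_left) auto
    finally show "t (barycenter \<sigma>) *\<^sub>R barycenter \<sigma> = \<dots>" .
  qed
  also have "\<dots> = (\<Sum>v\<in>M. ?x v *\<^sub>R v)"
    by (subst sum.swap) (simp add: flag_coords_def scaleR_sum_left o_def)
  also have "\<dots> = affine_extension \<Delta> (\<lambda>v. v) ?x"
    using affine_extension_simplex[OF ac M\<Delta> xM, of "\<lambda>v. v"] by simp
  finally show "affine_extension (barycentric_subdivision \<Delta>) (\<lambda>v. v) t =
     affine_extension \<Delta> (\<lambda>v. v) ?x" .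
qed

text \<open>Points with the same image have the same flag coordinates, because
  \<open>\<Delta>\<close> is geometric. \<open>flag_coords_recover\<close> then reads every weight
  off these coordinates by a formula that does not mention the flag, so points over different flags
  can be compared.\<close>

lemma geometric_complex_barycentric_subdivision:
  assumes "geometric_complex \<Delta>"
  shows "geometric_complex (barycentric_subdivision \<Delta>)"
  unfolding geometric_complex_def
proof
  have ac: "abstract_complex \<Delta>" using assms by (simp add: geometric_complex_def)
  note D = abstract_complexD[OF ac]
  show "abstract_complex (barycentric_subdivision \<Delta>)" by (rule abstract_complex_barycentric_subdivision[OF ac])
  show "inj_on (affine_extension (barycentric_subdivision \<Delta>) (\<lambda>v. v)) (realization (barycentric_subdivision \<Delta>))"
  proof (rule inj_onI)
    fix t t' assume "t \<in> realization (barycentric_subdivision \<Delta>)" "t' \<in> realization (barycentric_subdivision \<Delta>)"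
      and eq: "affine_extension (barycentric_subdivision \<Delta>) (\<lambda>v. v) t =
               affine_extension (barycentric_subdivision \<Delta>) (\<lambda>v. v) t'"
    then obtain C C' where C: "C \<subseteq> \<Delta>" "C \<noteq> {}" "chain\<^sub>\<subseteq> C" "t \<in> bary_simplex (barycenter ` C)"
      and C': "C' \<subseteq> \<Delta>" "C' \<noteq> {}" "chain\<^sub>\<subseteq> C'" "t' \<in> bary_simplex (barycenter ` C')"
      by (auto simp: realization_def barycentric_subdivision_def)
    have x: "flag_coords C (t \<circ> barycenter) = flag_coords C' (t' \<circ> barycenter)"
      using affine_extension_barycentric_subdivision[OF assms C]
        affine_extension_barycentric_subdivision[OF assms C'] eq assms
      by (auto simp: geometric_complex_def inj_on_def)
    have rec: "(s \<circ> barycenter) \<sigma> = real (card \<sigma>) * max 0 (Min (flag_coords B (s \<circ> barycenter) ` \<sigma>)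
        - Max (insert 0 (flag_coords B (s \<circ> barycenter) ` (\<Union>\<Delta> - \<sigma>))))"
      if "B \<subseteq> \<Delta>" "chain\<^sub>\<subseteq> B" "s \<in> bary_simplex (barycenter ` B)" "\<sigma> \<in> \<Delta>" for B s \<sigma>
    proof (rule flag_coords_recover)
      show "\<sigma> \<notin> B \<Longrightarrow> (s \<circ> barycenter) \<sigma> = 0"
        using that inj_on_image_mem_iff[OF inj_on_barycenter[OF assms] that(4,1)]
        by (auto simp: bary_simplex_def)
      show "finite B" using that(1) D(1) finite_subset by blast
      show "\<Union>B \<subseteq> \<Union>\<Delta>" "\<sigma> \<subseteq> \<Union>\<Delta>" using that by auto
      show "0 \<le> (s \<circ> barycenter) \<rho>" for \<rho> using that(3) by (simp add: bary_simplex_def)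
    qed (use that D(2,4) in blast)+
    have "t (barycenter \<sigma>) = t' (barycenter \<sigma>)" if "\<sigma> \<in> \<Delta>" for \<sigma>
      using rec[OF C(1,3,4) that] rec[OF C'(1,3,4) that] x by simp
    moreover have "t w = 0 \<and> t' w = 0" if "w \<notin> barycenter ` \<Delta>" for w
    proof -
      have "w \<notin> barycenter ` C" "w \<notin> barycenter ` C'" using that C(1) C'(1) by blast+
      then show ?thesis using C(4) C'(4) unfolding bary_simplex_def by blast
    qed
    ultimately show "t = t'" by (metis ext imageE)
  qed
qed

lemma polyhedron_of_barycentric_subdivision:
  assumes "geometric_complex \<Delta>"
  shows "polyhedron_of (barycentric_subdivision \<Delta>) = polyhedron_of \<Delta>"
proof
  have ac: "abstract_complex \<Delta>" using assms by (simp add: geometric_complex_def)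
  note D = abstract_complexD[OF ac] and ac' = abstract_complex_barycentric_subdivision[OF ac]
  show "polyhedron_of (barycentric_subdivision \<Delta>) \<subseteq> polyhedron_of \<Delta>"
    unfolding polyhedron_of_eq[OF ac, symmetric] polyhedron_of_eq[OF ac', symmetric]
  proof
    fix y assume "y \<in> affine_extension (barycentric_subdivision \<Delta>) (\<lambda>v. v) ` realization (barycentric_subdivision \<Delta>)"
    then obtain t C where C: "C \<subseteq> \<Delta>" "C \<noteq> {}" "chain\<^sub>\<subseteq> C" "t \<in> bary_simplex (barycenter ` C)"
      and y: "y = affine_extension (barycentric_subdivision \<Delta>) (\<lambda>v. v) t"
      by (auto simp: realization_def barycentric_subdivision_def)
    then show "y \<in> affine_extension \<Delta> (\<lambda>v. v) ` realization \<Delta>"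
      using affine_extension_barycentric_subdivision[OF assms C] by auto
  qed
  show "polyhedron_of \<Delta> \<subseteq> polyhedron_of (barycentric_subdivision \<Delta>)"
    unfolding polyhedron_of_eq[OF ac, symmetric] polyhedron_of_eq[OF ac', symmetric]
  proof
    fix y assume "y \<in> affine_extension \<Delta> (\<lambda>v. v) ` realization \<Delta>"
    then obtain x \<sigma> where x: "\<sigma> \<in> \<Delta>" "x \<in> bary_simplex \<sigma>" "y = affine_extension \<Delta> (\<lambda>v. v) x"
      by (auto simp: realization_def)
    \<comment> \<open>Restricting to the support makes all coordinates positive, as the construction
      of a flag requires.\<close>
    define S where "S = {v. x v \<noteq> 0}"
    have S\<sigma>: "S \<subseteq> \<sigma>" using x by (auto simp: S_def bary_simplex_def)
    then have fS: "finite S" using D(3)[OF x(1)] finite_subset by blast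
    have "0 < x v" if "v \<in> S" for v
      using that x(2) by (simp add: S_def bary_simplex_def order_less_le)
    moreover have "x v = 0" if "v \<notin> S" for v using that by (simp add: S_def)
    ultimately have "\<exists>C s. chain\<^sub>\<subseteq> C \<and> C \<subseteq> Pow S - {{}} \<and> (\<forall>\<sigma>. 0 \<le> s \<sigma>) \<and>
        (\<forall>\<sigma>. \<sigma> \<notin> C \<longrightarrow> s \<sigma> = 0) \<and> x = flag_coords C s"
      by (rule flag_coords_exists[OF fS])
    then obtain C s where C: "chain\<^sub>\<subseteq> C" "C \<subseteq> Pow S - {{}}" "\<forall>\<sigma>. 0 \<le> s \<sigma>"
      "\<forall>\<sigma>. \<sigma> \<notin> C \<longrightarrow> s \<sigma> = 0" "x = flag_coords C s"
      by (elim exE conjE)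
    have C\<Delta>: "C \<subseteq> \<Delta>" using C(2) S\<sigma> D(5)[OF x(1)] by blast
    have fC: "finite C" using C\<Delta> D(1) finite_subset by blast
    have "sum x \<sigma> = sum s C" unfolding C(5)
      using C(2) S\<sigma> by (intro sum_flag_coords fC D(3)[OF x(1)]) blast
    then have s1: "sum s C = 1" using x(2) by (simp add: bary_simplex_def)
    then have C0: "C \<noteq> {}" by auto
    have inj: "inj_on barycenter \<Delta>" by (rule inj_on_barycenter[OF assms])
    then have injC: "inj_on barycenter C" using C\<Delta> inj_on_subset by blast
    \<comment> \<open>The weights of the faces are moved to their barycenters; this is well defined
      because \<open>barycenter\<close> is injective on the flag.\<close>
    define t where "t w = (if w \<in> barycenter ` C then s (inv_into C barycenter w) else 0)" for w
    have tb: "t (barycenter \<rho>) = s \<rho>" if "\<rho> \<in> C" for \<rho> using that injC by (simp add: t_def)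
    have "t \<in> bary_simplex (barycenter ` C)"
      using C(3) s1 by (simp add: bary_simplex_def sum.reindex[OF injC] tb) (simp add: t_def)
    moreover have "flag_coords C (t \<circ> barycenter) = x"
      unfolding C(5) flag_coords_def by (intro ext sum.cong) (auto simp: tb)
    ultimately have "affine_extension (barycentric_subdivision \<Delta>) (\<lambda>v. v) t = y"
      and "t \<in> realization (barycentric_subdivision \<Delta>)"
      using affine_extension_barycentric_subdivision[OF assms C\<Delta> C0 C(1), of t] x(3)
        barycentric_subdivisionI[OF C\<Delta> C0 C(1)]
      by (auto simp: realization_def)
    then show "y \<in> affine_extension (barycentric_subdivision \<Delta>) (\<lambda>v. v) ` realization (barycentric_subdivision \<Delta>)"
      by blast
  qed
qed

section \<open>The mesh of iterated subdivisions\<close>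

text \<open>Only distances between vertices count, since labels are compared only at the two ends of
  an edge.\<close>

definition mesh_le :: "'a::metric_space set set \<Rightarrow> real \<Rightarrow> bool" where
  "mesh_le \<Delta> r \<longleftrightarrow> (\<forall>\<sigma>\<in>\<Delta>. \<forall>u\<in>\<sigma>. \<forall>v\<in>\<sigma>. dist u v \<le> r)"

text \<open>The vector from \<open>v\<close> to the barycenter is the mean of the differences
  \<open>w - v\<close>, one of which vanishes; this gains the factor
  \<open>1 - 1 / card \<tau>\<close>. Balls are convex, so the bound passes from vertices to the
  hull. Weakening \<open>card \<tau>\<close> to \<open>N\<close> gives one factor for all
  simplices.\<close>

lemma dist_barycenter_le:
  fixes \<tau> :: "'a::real_normed_vector set"
  assumes "finite \<tau>" "\<tau> \<noteq> {}" "\<And>u v. u \<in> \<tau> \<Longrightarrow> v \<in> \<tau> \<Longrightarrow> dist u v \<le> r"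
    and "card \<tau> \<le> N" "x \<in> convex hull \<tau>"
  shows "dist (barycenter \<tau>) x \<le> (1 - 1 / real N) * r"
proof -
  define m where "m = real (card \<tau>)"
  have m: "m \<ge> 1" using assms(1,2) by (simp add: m_def Suc_le_eq card_gt_0_iff)
  have mN: "m \<le> real N" using assms(4) by (simp add: m_def)
  have r0: "0 \<le> r" using assms(2,3) by (metis all_not_in_conv dist_self)
  have "dist (barycenter \<tau>) v \<le> (1 - 1 / real N) * r" if v: "v \<in> \<tau>" for v
  proof -
    have "barycenter \<tau> - v = (1 / m) *\<^sub>R (\<Sum>w\<in>\<tau>. w - v)"
      using m by (simp add: barycenter_def m_def sum_subtractf scaleR_diff_right sum_constant_scaleR)
    also have "(\<Sum>w\<in>\<tau>. w - v) = (\<Sum>w\<in>\<tau> - {v}. w - v)"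
      by (intro sum.mono_neutral_right) (use assms in auto)
    finally have "norm (barycenter \<tau> - v) = (1 / m) * norm (\<Sum>w\<in>\<tau> - {v}. w - v)"
      using m by simp
    also have "norm (\<Sum>w\<in>\<tau> - {v}. w - v) \<le> (\<Sum>w\<in>\<tau> - {v}. r)"
      by (rule sum_norm_le) (use assms(3) v in \<open>auto simp: dist_norm\<close>)
    also have "\<dots> = (m - 1) * r"
      using assms(1) v m by (simp add: m_def card_Diff_singleton of_nat_diff)
    finally have "norm (barycenter \<tau> - v) \<le> (1 / m) * ((m - 1) * r)"
      using m by (simp add: divide_right_mono)
    also have "\<dots> = (1 - 1 / m) * r" using m by (simp add: field_simps)
    also have "\<dots> \<le> (1 - 1 / real N) * r"
      using m mN r0 by (intro mult_right_mono diff_left_mono divide_left_mono) auto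
    finally show ?thesis by (simp add: dist_norm)
  qed
  then have "convex hull \<tau> \<subseteq> cball (barycenter \<tau>) ((1 - 1 / real N) * r)"
    by (intro hull_minimal convex_cball) auto
  then show ?thesis using assms(5) by auto
qed

text \<open>Any two vertices of a new simplex are barycenters of nested faces. The second claim
  keeps the contraction factor fixed under iteration: the members of a flag have distinct
  cardinalities between 1 and \<open>N\<close>.\<close>

lemma mesh_barycentric_subdivision:
  fixes \<Delta> :: "'a::real_normed_vector set set"
  assumes ac: "abstract_complex \<Delta>" and N: "\<forall>\<sigma>\<in>\<Delta>. card \<sigma> \<le> N" and r: "mesh_le \<Delta> r"
  shows "mesh_le (barycentric_subdivision \<Delta>) ((1 - 1 / real N) * r)"
    "\<forall>\<sigma>\<in>barycentric_subdivision \<Delta>. card \<sigma> \<le> N"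
proof -
  note D = abstract_complexD[OF ac]
  have le: "dist (barycenter \<tau>) (barycenter \<sigma>) \<le> (1 - 1 / real N) * r"
    if "\<tau> \<in> \<Delta>" "\<sigma> \<in> \<Delta>" "\<sigma> \<subseteq> \<tau>" for \<sigma> \<tau>
  proof (rule dist_barycenter_le)
    show "barycenter \<sigma> \<in> convex hull \<tau>"
      using barycenter_in_hull[OF D(3,4)[OF that(2)]] hull_mono[OF that(3)] by blast
  qed (use that N r D(3,4) in \<open>auto simp: mesh_le_def\<close>)
  show "mesh_le (barycentric_subdivision \<Delta>) ((1 - 1 / real N) * r)"
    unfolding mesh_le_def
  proof (intro ballI)
    fix S u v assume "S \<in> barycentric_subdivision \<Delta>" "u \<in> S" "v \<in> S"
    then obtain C \<sigma> \<tau> where "C \<subseteq> \<Delta>" "chain\<^sub>\<subseteq> C" "\<sigma> \<in> C" "\<tau> \<in> C" "u = barycenter \<sigma>" "v = barycenter \<tau>"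
      by (auto simp: barycentric_subdivision_def)
    then show "dist u v \<le> (1 - 1 / real N) * r"
      using le[of \<sigma> \<tau>] le[of \<tau> \<sigma>] unfolding chain_subset_def
      by (metis dist_commute subset_iff)
  qed
  show "\<forall>\<sigma>\<in>barycentric_subdivision \<Delta>. card \<sigma> \<le> N"
  proof
    fix S assume "S \<in> barycentric_subdivision \<Delta>"
    then obtain C where C: "C \<subseteq> \<Delta>" "C \<noteq> {}" "chain\<^sub>\<subseteq> C" "S = barycenter ` C"
      by (auto simp: barycentric_subdivision_def)
    have fC: "finite C" using C(1) D(1) finite_subset by blast
    have "inj_on card C"
    proof (rule inj_onI)
      fix \<sigma> \<tau> assume st: "\<sigma> \<in> C" "\<tau> \<in> C" "card \<sigma> = card \<tau>"
      then have "finite \<sigma>" "finite \<tau>" using C(1) D(3) by blast+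
      moreover have "\<sigma> \<subseteq> \<tau> \<or> \<tau> \<subseteq> \<sigma>" using C(3) st by (auto simp: chain_subset_def)
      ultimately show "\<sigma> = \<tau>" using st(3) card_subset_eq by metis
    qed
    moreover have "card ` C \<subseteq> {1..N}"
      using C(1) N D(3,4) by (force simp: Suc_le_eq card_gt_0_iff)
    ultimately have "card C \<le> card {1..N}" by (intro card_inj_on_le[of card]) auto
    then show "card S \<le> N" using card_image_le[OF fC, of barycenter] C(4) by simp
  qed
qed

section \<open>Antipodal triangulations\<close>

text \<open>Each coordinate of \<open>A\<close> and its negative are convex, so Jensen's inequality
  holds in both directions.\<close>

lemma affine_on_combination:
  fixes A :: "'a::real_vector \<Rightarrow> 'b::euclidean_space"
  assumes "convex S"
    and A: "\<And>x y u. x \<in> S \<Longrightarrow> y \<in> S \<Longrightarrow> u \<in> {0..1} \<Longrightarrow>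
      A ((1 - u) *\<^sub>R x + u *\<^sub>R y) = (1 - u) *\<^sub>R A x + u *\<^sub>R A y"
    and I: "finite I" "I \<noteq> {}" "(\<Sum>i\<in>I. a i) = 1" "\<And>i. i \<in> I \<Longrightarrow> 0 \<le> a i" "\<And>i. i \<in> I \<Longrightarrow> y i \<in> S"
  shows "A (\<Sum>i\<in>I. a i *\<^sub>R y i) = (\<Sum>i\<in>I. a i *\<^sub>R A (y i))"
proof (rule euclidean_eqI)
  fix b :: 'b assume "b \<in> Basis"
  have "convex_on S (\<lambda>x. A x \<bullet> b)" "convex_on S (\<lambda>x. - (A x \<bullet> b))"
    using assms(1) A by (auto intro!: convex_onI simp: inner_add_left)
  from this[THEN convex_on_sum[OF I(1,2)], OF I(3) I(4,5)]
  have "A (\<Sum>i\<in>I. a i *\<^sub>R y i) \<bullet> b \<le> (\<Sum>i\<in>I. a i * (A (y i) \<bullet> b))"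
    "- (A (\<Sum>i\<in>I. a i *\<^sub>R y i) \<bullet> b) \<le> (\<Sum>i\<in>I. a i * - (A (y i) \<bullet> b))" by auto
  then show "A (\<Sum>i\<in>I. a i *\<^sub>R y i) \<bullet> b = (\<Sum>i\<in>I. a i *\<^sub>R A (y i)) \<bullet> b"
    by (simp add: inner_sum_left sum_negf)
qed

lemma bary_simplex_unique:
  fixes \<sigma> :: "'a::real_vector set"
  assumes "\<not> affine_dependent \<sigma>" "finite \<sigma>" "t \<in> bary_simplex \<sigma>" "t' \<in> bary_simplex \<sigma>"
    and "(\<Sum>v\<in>\<sigma>. t v *\<^sub>R v) = (\<Sum>v\<in>\<sigma>. t' v *\<^sub>R v)"
  shows "t = t'"
proof (rule ccontr)
  assume "t \<noteq> t'"
  then obtain v where v: "t v \<noteq> t' v" by auto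
  then have "v \<in> \<sigma>" using assms(3,4) by (force simp: bary_simplex_def)
  moreover have "sum (\<lambda>v. t v - t' v) \<sigma> = 0" using assms(3,4) by (simp add: bary_simplex_def sum_subtractf)
  moreover have "(\<Sum>v\<in>\<sigma>. (t v - t' v) *\<^sub>R v) = 0" using assms(5) by (simp add: scaleR_diff_left sum_subtractf)
  ultimately have "affine_dependent \<sigma>"
    using v unfolding affine_dependent_explicit_finite[OF assms(2)]
    by (intro exI[of _ "\<lambda>v. t v - t' v"]) auto
  then show False using assms(1) by blast
qed

lemma bary_simplex_mono: "finite \<sigma> \<Longrightarrow> \<rho> \<subseteq> \<sigma> \<Longrightarrow> bary_simplex \<rho> \<subseteq> bary_simplex \<sigma>"
proof
  fix t assume fin: "finite \<sigma>" and sub: "\<rho> \<subseteq> \<sigma>" and t: "t \<in> bary_simplex \<rho>"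
  have "sum t \<sigma> = sum t \<rho>"
    using fin sub t by (intro sum.mono_neutral_right) (auto simp: bary_simplex_def)
  then show "t \<in> bary_simplex \<sigma>" using t sub by (auto simp: bary_simplex_def)
qed

section \<open>From Euclidean simplices to their vertex sets\<close>

text \<open>A simplex is the hull of its extreme points, so nothing is lost. The empty simplex is
  dropped because \<open>abstract_complex\<close> forbids it.\<close>

definition vertex_complex :: "'a::euclidean_space set set \<Rightarrow> 'a set set" where
  "vertex_complex K = {{x. x extreme_point_of S} | S. S \<in> K \<and> S \<noteq> {}}"

lemma simplex_extreme_points:
  assumes "n simplex S"
  defines "C \<equiv> {x. x extreme_point_of S}"
  shows "\<not> affine_dependent C" "finite C" "S = convex hull C"
proof -
  obtain B where B: "\<not> affine_dependent B" "S = convex hull B" using assms by (auto simp: simplex)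
  then have "C = B" unfolding C_def using extreme_point_of_convex_hull_affine_independent by auto
  then show "\<not> affine_dependent C" "finite C" "S = convex hull C" using B aff_independent_finite by auto
qed

lemma vertex_complex_iff:
  assumes "simplicial_complex K"
  shows "\<sigma> \<in> vertex_complex K \<longleftrightarrow> \<sigma> \<noteq> {} \<and> \<not> affine_dependent \<sigma> \<and> convex hull \<sigma> \<in> K"
proof
  assume "\<sigma> \<in> vertex_complex K"
  then obtain S n where "S \<in> K" "S \<noteq> {}" "\<sigma> = {x. x extreme_point_of S}" "n simplex S"
    using assms unfolding vertex_complex_def simplicial_complex_def by blast
  then show "\<sigma> \<noteq> {} \<and> \<not> affine_dependent \<sigma> \<and> convex hull \<sigma> \<in> K"
    using simplex_extreme_points[of n S] by auto
next
  assume s: "\<sigma> \<noteq> {} \<and> \<not> affine_dependent \<sigma> \<and> convex hull \<sigma> \<in> K"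
  then have "\<sigma> = {x. x extreme_point_of convex hull \<sigma>}"
    using extreme_point_of_convex_hull_affine_independent by auto
  then show "\<sigma> \<in> vertex_complex K" using s unfolding vertex_complex_def by auto
qed

text \<open>If a point lies over both \<open>\<sigma>\<close> and \<open>\<sigma>'\<close>, it lies
  in the common face \<open>F\<close> of their hulls. The extreme points of \<open>F\<close> form a
  set \<open>\<rho>\<close> contained in both, and affine independence in each of the two simplices
  forces both coordinate functions to equal the one on \<open>\<rho>\<close>.\<close>

lemma geometric_vertex_complex:
  assumes K: "simplicial_complex K"
  shows "geometric_complex (vertex_complex K)"
proof -
  note iff = vertex_complex_iff[OF K]
  have face: "F \<in> K" if "S \<in> K" "F face_of S" for S F using K that unfolding simplicial_complex_def by blast
  have ac: "abstract_complex (vertex_complex K)"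
    unfolding abstract_complex_def
  proof (intro conjI ballI allI impI)
    have "finite K" using K by (simp add: simplicial_complex_def)
    then show "finite (vertex_complex K)" unfolding vertex_complex_def by simp
    fix \<sigma> assume s: "\<sigma> \<in> vertex_complex K"
    then show "finite \<sigma>" "\<sigma> \<noteq> {}" using iff aff_independent_finite by auto
    fix \<tau> assume t: "\<tau> \<subseteq> \<sigma> \<and> \<tau> \<noteq> {}"
    have "convex hull \<tau> face_of convex hull \<sigma>"
      using s t iff face_of_convex_hull_affine_independent by blast
    then show "\<tau> \<in> vertex_complex K"
      using s t iff face affine_independent_subset by metis
  qed
  have "inj_on (affine_extension (vertex_complex K) (\<lambda>v. v)) (realization (vertex_complex K))"
  proof (rule inj_onI)
    fix t t' assume "t \<in> realization (vertex_complex K)" "t' \<in> realization (vertex_complex K)"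
      and eq: "affine_extension (vertex_complex K) (\<lambda>v. v) t = affine_extension (vertex_complex K) (\<lambda>v. v) t'"
    then obtain \<sigma> \<sigma>' where s: "\<sigma> \<in> vertex_complex K" "t \<in> bary_simplex \<sigma>"
      and s': "\<sigma>' \<in> vertex_complex K" "t' \<in> bary_simplex \<sigma>'" by (auto simp: realization_def)
    define x where "x = affine_extension (vertex_complex K) (\<lambda>v. v) t"
    define F where "F = convex hull \<sigma> \<inter> convex hull \<sigma>'"
    have i: "\<not> affine_dependent \<sigma>" "\<not> affine_dependent \<sigma>'" "convex hull \<sigma> \<in> K" "convex hull \<sigma>' \<in> K"
      using iff s s' by auto
    have "x \<in> F" unfolding F_def
      using affine_extension_in_hull[OF ac s, of "\<lambda>v. v"] affine_extension_in_hull[OF ac s', of "\<lambda>v. v"] eq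
      by (simp add: x_def)
    have "F face_of convex hull \<sigma>" "F face_of convex hull \<sigma>'"
      using K i unfolding F_def simplicial_complex_def by (blast, metis Int_commute)
    then obtain \<rho> \<rho>' where r: "\<rho> \<subseteq> \<sigma>" "F = convex hull \<rho>" and r': "\<rho>' \<subseteq> \<sigma>'" "F = convex hull \<rho>'"
      using face_of_convex_hull_affine_independent i by metis
    have "\<rho> = \<rho>'"
      using extreme_point_of_convex_hull_affine_independent[of \<rho>] extreme_point_of_convex_hull_affine_independent[of \<rho>']
        affine_independent_subset[OF i(1) r(1)] affine_independent_subset[OF i(2) r'(1)] r r' by auto
    have "\<rho> \<noteq> {}" using \<open>x \<in> F\<close> r by auto
    then have "\<rho> \<in> vertex_complex K" using abstract_complexD(5)[OF ac s(1) r(1)] by blast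
    then obtain t'' where t'': "t'' \<in> bary_simplex \<rho>" "x = affine_extension (vertex_complex K) (\<lambda>v. v) t''"
      using affine_extension_image[OF ac] \<open>x \<in> F\<close> r(2) by blast
    have uniq: "u = t''" if "u \<in> bary_simplex \<omega>" "\<omega> \<in> vertex_complex K" "\<rho> \<subseteq> \<omega>"
      "affine_extension (vertex_complex K) (\<lambda>v. v) u = x" for u \<omega>
    proof -
      have fin: "finite \<omega>" using abstract_complexD(3)[OF ac] that by blast
      then have "t'' \<in> bary_simplex \<omega>" using t'' bary_simplex_mono that by blast
      then show ?thesis
        using that fin iff t''(2) affine_extension_simplex[OF ac that(2), of _ "\<lambda>v. v"]
        by (intro bary_simplex_unique[of \<omega>]) auto
    qed
    show "t = t'" using uniq[OF s(2,1) r(1)] uniq[OF s'(2,1)] r'(1) \<open>\<rho> = \<rho>'\<close> eq x_def by simp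
  qed
  then show ?thesis using ac by (simp add: geometric_complex_def)
qed

lemma polyhedron_of_vertex_complex:
  assumes K: "simplicial_complex K"
  shows "polyhedron_of (vertex_complex K) = \<Union>K"
proof -
  have "\<exists>\<sigma>\<in>vertex_complex K. x \<in> convex hull \<sigma>" if S: "x \<in> S" "S \<in> K" for x S
  proof -
    obtain n where "n simplex S" using K S unfolding simplicial_complex_def by blast
    then have "S = convex hull {x. x extreme_point_of S}" by (rule simplex_extreme_points)
    then show ?thesis using S unfolding vertex_complex_def by blast
  qed
  then show ?thesis unfolding polyhedron_of_def using vertex_complex_iff[OF K] by blast
qed

section \<open>Free simplicial involutions and invariant triangulations\<close>

locale free_simplicial_involution =
  fixes K :: "'a::euclidean_space set set" and A :: "'a \<Rightarrow> 'a"
  assumes complex: "simplicial_complex K"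
    and simplicial: "simplicial_self_map K A"
    and free: "free_involution_on (\<Union>K) A"
begin

lemma A_in: "x \<in> \<Union>K \<Longrightarrow> A x \<in> \<Union>K" and A_A: "x \<in> \<Union>K \<Longrightarrow> A (A x) = x"
  and A_neq: "x \<in> \<Union>K \<Longrightarrow> A x \<noteq> x"
  using free unfolding free_involution_on_def by blast+

lemma A_image_in: "S \<in> K \<Longrightarrow> A ` S \<in> K"
  using simplicial unfolding simplicial_self_map_def by blast

lemma A_affine: "S \<in> K \<Longrightarrow> x \<in> S \<Longrightarrow> y \<in> S \<Longrightarrow> u \<in> {0..1} \<Longrightarrow>
    A ((1 - u) *\<^sub>R x + u *\<^sub>R y) = (1 - u) *\<^sub>R A x + u *\<^sub>R A y"
  using simplicial unfolding simplicial_self_map_def by blast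

lemma simplex_in: "S \<in> K \<Longrightarrow> \<exists>n. n simplex S"
  using complex unfolding simplicial_complex_def by blast

lemma convex_in: "S \<in> K \<Longrightarrow> convex S"
  using simplex_in convex_simplex by blast

lemma hull_in: "S \<in> K \<Longrightarrow> \<sigma> \<subseteq> S \<Longrightarrow> convex hull \<sigma> \<subseteq> S"
  by (simp add: hull_minimal convex_in)

lemma A_A_image: "T \<subseteq> \<Union>K \<Longrightarrow> A ` A ` T = T"
  using A_A by (force simp: image_image)

lemma inj_on_A: "inj_on A (\<Union>K)"
  by (rule inj_onI) (metis A_A)

text \<open>A simplex meeting its image would contain the midpoint of some \<open>x\<close> and \<open>A x\<close>, which
  is fixed by \<open>A\<close>.\<close>

lemma A_disjoint:
  assumes "S \<in> K"
  shows "S \<inter> A ` S = {}"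
proof (rule ccontr)
  assume "S \<inter> A ` S \<noteq> {}"
  then obtain x where x: "x \<in> S" "x \<in> A ` S" by blast
  then obtain y where y: "y \<in> S" "x = A y" by blast
  then have Ax: "A x = y" using A_A assms by blast
  define z where "z = (1 - 1 / 2) *\<^sub>R x + (1 / 2) *\<^sub>R y"
  have "z \<in> S" unfolding z_def using convexD_alt[OF convex_in[OF assms] x(1) y(1), of "1/2"] by simp
  have "A z = (1 - 1 / 2) *\<^sub>R A x + (1 / 2) *\<^sub>R A y"
    unfolding z_def by (rule A_affine[OF assms x(1) y(1)]) simp
  also have "\<dots> = z" using Ax y(2) by (simp add: z_def)
  finally show False using A_neq \<open>z \<in> S\<close> assms by blast
qed

lemma A_combination:
  assumes "S \<in> K" "finite I" "I \<noteq> {}" "(\<Sum>i\<in>I. a i) = 1" "\<And>i. i \<in> I \<Longrightarrow> 0 \<le> a i" "\<And>i. i \<in> I \<Longrightarrow> y i \<in> S"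
  shows "A (\<Sum>i\<in>I. a i *\<^sub>R y i) = (\<Sum>i\<in>I. a i *\<^sub>R A (y i))"
  by (rule affine_on_combination[OF convex_in[OF assms(1)] A_affine[OF assms(1)] assms(2-6)])

text \<open>Affinity gives one inclusion; applied to the image of \<open>\<sigma>\<close> and
  combined with \<open>A\<close> being an involution, it also gives the other.\<close>

lemma A_hull:
  assumes "S \<in> K" "finite \<sigma>" "\<sigma> \<noteq> {}" "\<sigma> \<subseteq> S"
  shows "A ` (convex hull \<sigma>) = convex hull (A ` \<sigma>)"
proof -
  have sub: "A ` (convex hull \<tau>) \<subseteq> convex hull (A ` \<tau>)"
    if \<tau>: "T \<in> K" "finite \<tau>" "\<tau> \<noteq> {}" "\<tau> \<subseteq> T" for \<tau> T
  proof
    fix z assume "z \<in> A ` (convex hull \<tau>)"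
    then obtain u where u: "\<forall>x\<in>\<tau>. 0 \<le> u x" "sum u \<tau> = 1" "z = A (\<Sum>x\<in>\<tau>. u x *\<^sub>R x)"
      using convex_hull_finite[OF \<tau>(2)] by auto
    then have "z = (\<Sum>x\<in>\<tau>. u x *\<^sub>R A x)"
      using A_combination[OF \<tau>(1-3), of u "\<lambda>x. x"] \<tau>(4) by auto
    also have "\<dots> \<in> convex hull (A ` \<tau>)"
      using u \<tau>(2) by (intro convex_sum convex_convex_hull) (auto intro: hull_inc)
    finally show "z \<in> convex hull (A ` \<tau>)" .
  qed
  have "A ` \<sigma> \<subseteq> A ` S" using assms(4) by blast
  have hK: "convex hull (A ` \<sigma>) \<subseteq> \<Union>K"
    using hull_in[OF A_image_in[OF assms(1)] \<open>A ` \<sigma> \<subseteq> A ` S\<close>] A_image_in[OF assms(1)] by blast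
  have "A ` (convex hull (A ` \<sigma>)) \<subseteq> convex hull (A ` A ` \<sigma>)"
    using assms by (intro sub[OF A_image_in[OF assms(1)]]) auto
  also have "A ` A ` \<sigma> = \<sigma>" using assms by (intro A_A_image) blast
  finally have "A ` A ` (convex hull (A ` \<sigma>)) \<subseteq> A ` (convex hull \<sigma>)" by blast
  then show ?thesis using sub[OF assms] A_A_image[OF hK] by blast
qed

text \<open>Requiring each simplex to lie in a simplex of \<open>K\<close> makes \<open>A\<close>
  affine on it; this is what lets invariance survive subdivision.\<close>

definition invariant_triangulation :: "'a set set \<Rightarrow> bool" where
  "invariant_triangulation \<Delta> \<longleftrightarrow> geometric_complex \<Delta> \<and> polyhedron_of \<Delta> = \<Union>K \<and>
     (\<forall>\<sigma>\<in>\<Delta>. \<exists>S\<in>K. \<sigma> \<subseteq> S) \<and> (\<forall>\<sigma>\<in>\<Delta>. A ` \<sigma> \<in> \<Delta>)"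

lemma A_barycenter:
  assumes "S \<in> K" "finite \<sigma>" "\<sigma> \<noteq> {}" "\<sigma> \<subseteq> S"
  shows "A (barycenter \<sigma>) = barycenter (A ` \<sigma>)"
proof -
  have inj: "inj_on A \<sigma>" using assms by (intro inj_on_subset[OF inj_on_A]) blast
  have "A (barycenter \<sigma>) = (\<Sum>v\<in>\<sigma>. (1 / real (card \<sigma>)) *\<^sub>R A v)"
    unfolding barycenter_eq_sum using assms by (intro A_combination[OF assms(1-3)]) auto
  then show ?thesis by (simp add: barycenter_eq_sum sum.reindex[OF inj] card_image[OF inj])
qed

text \<open>\<open>A\<close> commutes with barycenters and maps flags to flags. A new simplex stays
  in the simplex of \<open>K\<close> that contains the greatest face of its flag.\<close>

lemma invariant_barycentric_subdivision:
  assumes "invariant_triangulation \<Delta>"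
  shows "invariant_triangulation (barycentric_subdivision \<Delta>)"
  unfolding invariant_triangulation_def
proof (intro conjI ballI)
  have g: "geometric_complex \<Delta>" and p: "polyhedron_of \<Delta> = \<Union>K"
    and r: "\<And>\<sigma>. \<sigma> \<in> \<Delta> \<Longrightarrow> \<exists>S\<in>K. \<sigma> \<subseteq> S" and A: "\<And>\<sigma>. \<sigma> \<in> \<Delta> \<Longrightarrow> A ` \<sigma> \<in> \<Delta>"
    using assms by (auto simp: invariant_triangulation_def)
  then have ac: "abstract_complex \<Delta>" by (simp add: geometric_complex_def)
  note D = abstract_complexD[OF ac]
  show "geometric_complex (barycentric_subdivision \<Delta>)"
    by (rule geometric_complex_barycentric_subdivision[OF g])
  show "polyhedron_of (barycentric_subdivision \<Delta>) = \<Union>K"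
    using polyhedron_of_barycentric_subdivision[OF g] p by simp
  fix \<rho> assume "\<rho> \<in> barycentric_subdivision \<Delta>"
  then obtain C where C: "C \<subseteq> \<Delta>" "C \<noteq> {}" "chain\<^sub>\<subseteq> C" "\<rho> = barycenter ` C"
    unfolding barycentric_subdivision_def by blast
  have "finite C" using C(1) D(1) finite_subset by blast
  then obtain M where M: "M \<in> C" "\<And>\<sigma>. \<sigma> \<in> C \<Longrightarrow> \<sigma> \<subseteq> M" using finite_chain_greatest C by metis
  obtain S where S: "S \<in> K" "M \<subseteq> S" using M C r by blast
  have "barycenter \<sigma> \<in> S" if "\<sigma> \<in> C" for \<sigma>
  proof -
    have "\<sigma> \<in> \<Delta>" "\<sigma> \<subseteq> S" using that C M S by blast+
    then show ?thesis
      using barycenter_in_hull[OF D(3,4)] hull_in[OF S(1)] by blast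
  qed
  then show "\<exists>S\<in>K. \<rho> \<subseteq> S" using C(4) S(1) by blast
  have "A (barycenter \<sigma>) = barycenter (A ` \<sigma>)" if "\<sigma> \<in> C" for \<sigma>
    using that C(1) r D(3,4) by (metis A_barycenter subsetD)
  then have "A ` \<rho> = barycenter ` ((`) A ` C)" using C(4) by (simp add: image_image)
  also have "\<dots> \<in> barycentric_subdivision \<Delta>"
  proof (rule barycentric_subdivisionI)
    show "(`) A ` C \<subseteq> \<Delta>" using A C(1) by blast
    show "(`) A ` C \<noteq> {}" using C(2) by blast
    show "chain\<^sub>\<subseteq> ((`) A ` C)" using C(3) unfolding chain_subset_def by (simp add: ball_simps) (blast intro: image_mono)
  qed
  finally show "A ` \<rho> \<in> barycentric_subdivision \<Delta>" .
qed

text \<open>A segment through \<open>A x\<close> in the image is carried back by \<open>A\<close> to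
  a segment through \<open>x\<close> in \<open>S\<close>.\<close>

lemma A_extreme_point:
  assumes "S \<in> K" "x extreme_point_of S"
  shows "A x extreme_point_of (A ` S)"
  unfolding extreme_point_of_def
proof (intro conjI ballI notI)
  have xS: "x \<in> S" using assms(2) by (simp add: extreme_point_of_def)
  then show "A x \<in> A ` S" by blast
  fix a b assume ab: "a \<in> A ` S" "b \<in> A ` S" "A x \<in> open_segment a b"
  note AS = A_image_in[OF assms(1)]
  obtain u where u: "a \<noteq> b" "0 < u" "u < 1" "A x = (1 - u) *\<^sub>R a + u *\<^sub>R b"
    using ab(3) unfolding in_segment by blast
  have AA: "A a \<in> S" "A b \<in> S" using ab A_A_image[of S] assms(1) by blast+
  have "A (A x) = (1 - u) *\<^sub>R A a + u *\<^sub>R A b"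
    unfolding u(4) using u by (intro A_affine[OF AS ab(1,2)]) auto
  moreover have "A (A x) = x" using A_A xS assms(1) by blast
  moreover have "A a \<noteq> A b" using u(1) ab AS inj_on_A by (metis UnionI inj_onD)
  ultimately have "x \<in> open_segment (A a) (A b)" using u unfolding in_segment by auto
  then show False using assms(2) AA by (auto simp: extreme_point_of_def)
qed

lemma invariant_vertex_complex: "invariant_triangulation (vertex_complex K)"
  unfolding invariant_triangulation_def
proof (intro conjI ballI)
  show "geometric_complex (vertex_complex K)" by (rule geometric_vertex_complex[OF complex])
  show "polyhedron_of (vertex_complex K) = \<Union>K" by (rule polyhedron_of_vertex_complex[OF complex])
  fix \<sigma> assume "\<sigma> \<in> vertex_complex K"
  then obtain S where S: "S \<in> K" "S \<noteq> {}" "\<sigma> = {x. x extreme_point_of S}"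
    by (auto simp: vertex_complex_def)
  then show "\<exists>S\<in>K. \<sigma> \<subseteq> S" by (auto simp: extreme_point_of_def)
  have "A ` \<sigma> = {x. x extreme_point_of (A ` S)}"
  proof
    show "A ` \<sigma> \<subseteq> {x. x extreme_point_of (A ` S)}" using A_extreme_point S by auto
    show "{x. x extreme_point_of (A ` S)} \<subseteq> A ` \<sigma>"
    proof
      fix x assume x: "x \<in> {x. x extreme_point_of (A ` S)}"
      then have "A x extreme_point_of (A ` A ` S)" using A_extreme_point A_image_in S by blast
      moreover have "A ` A ` S = S" using A_A_image S by blast
      moreover have "x \<in> \<Union>K" using x A_image_in[OF S(1)] by (auto simp: extreme_point_of_def)
      ultimately show "x \<in> A ` \<sigma>" using A_A[of x] S(3) by (intro image_eqI[of _ _ "A x"]) auto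
    qed
  qed
  then show "A ` \<sigma> \<in> vertex_complex K"
    using A_image_in[OF S(1)] S(2) unfolding vertex_complex_def by blast
qed

lemma invariant_triangulation_fine:
  assumes "e > 0"
  obtains \<Delta> where "invariant_triangulation \<Delta>" "\<And>\<sigma> u v. \<sigma> \<in> \<Delta> \<Longrightarrow> u \<in> \<sigma> \<Longrightarrow> v \<in> \<sigma> \<Longrightarrow> dist u v < e"
proof -
  let ?V = "vertex_complex K"
  have ac: "abstract_complex ?V" using geometric_vertex_complex[OF complex] by (simp add: geometric_complex_def)
  note D = abstract_complexD[OF ac]
  \<comment> \<open>A common bound for the cardinalities of simplices. The \<open>Suc\<close> keeps
    \<open>N\<close> positive even for an empty complex, so \<open>1 - 1 / real N\<close> lies in
    [0, 1) and its powers tend to 0.\<close>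
  define N where "N = Suc (card (\<Union>?V))"
  have cN: "card \<sigma> \<le> N" if "\<sigma> \<in> ?V" for \<sigma>
    using card_mono[OF D(2) Union_upper[OF that]] by (simp add: N_def)
  have "bounded (\<Union>?V)" using D(2) finite_imp_bounded by blast
  then obtain r where "\<forall>u\<in>\<Union>?V. \<forall>v\<in>\<Union>?V. dist u v \<le> r"
    using bounded_two_points by blast
  then have r: "mesh_le ?V r" unfolding mesh_le_def by blast
  have iter: "\<exists>\<Delta>. invariant_triangulation \<Delta> \<and> mesh_le \<Delta> ((1 - 1 / real N) ^ k * r) \<and> (\<forall>\<sigma>\<in>\<Delta>. card \<sigma> \<le> N)" for k
  proof (induction k)
    case 0
    then show ?case using invariant_vertex_complex r cN by (intro exI[of _ ?V]) auto
  next
    case (Suc k)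
    then obtain \<Delta> where \<Delta>: "invariant_triangulation \<Delta>" "mesh_le \<Delta> ((1 - 1 / real N) ^ k * r)" "\<forall>\<sigma>\<in>\<Delta>. card \<sigma> \<le> N"
      by blast
    then have "abstract_complex \<Delta>" by (simp add: invariant_triangulation_def geometric_complex_def)
    from mesh_barycentric_subdivision[OF this \<Delta>(3,2)] invariant_barycentric_subdivision[OF \<Delta>(1)]
    show ?case by (intro exI[of _ "barycentric_subdivision \<Delta>"]) (auto simp: mult.assoc)
  qed
  have "(\<lambda>k. (1 - 1 / real N) ^ k * r) \<longlonglongrightarrow> 0 * r"
    by (intro tendsto_mult LIMSEQ_power_zero tendsto_const) (auto simp: N_def)
  then have "\<forall>\<^sub>F k in sequentially. (1 - 1 / real N) ^ k * r < e"
    using assms by (intro order_tendstoD(2)) auto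
  then obtain k where k: "(1 - 1 / real N) ^ k * r < e" by (meson eventually_happens sequentially_bot)
  from iter[of k] obtain \<Delta> where "invariant_triangulation \<Delta>" "mesh_le \<Delta> ((1 - 1 / real N) ^ k * r)" by blast
  then show thesis using that[of \<Delta>] k unfolding mesh_le_def by force
qed

lemma antipodal_triangulation_invariant:
  assumes "invariant_triangulation \<Delta>"
  shows "antipodal_triangulation (\<Union>K) A \<Delta> (affine_extension \<Delta> (\<lambda>v. v))"
  unfolding antipodal_triangulation_def
proof (intro conjI ballI)
  have g: "geometric_complex \<Delta>" and p: "polyhedron_of \<Delta> = \<Union>K"
    and r: "\<And>\<sigma>. \<sigma> \<in> \<Delta> \<Longrightarrow> \<exists>S\<in>K. \<sigma> \<subseteq> S" and A: "\<And>\<sigma>. \<sigma> \<in> \<Delta> \<Longrightarrow> A ` \<sigma> \<in> \<Delta>"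
    using assms by (auto simp: invariant_triangulation_def)
  then have ac: "abstract_complex \<Delta>" by (simp add: geometric_complex_def)
  note D = abstract_complexD[OF ac]
  show "triangulation_of (\<Union>K) \<Delta> (affine_extension \<Delta> (\<lambda>v. v))"
    using triangulation_of_geometric_complex[OF g] p by simp
  fix \<sigma> assume \<sigma>: "\<sigma> \<in> \<Delta>"
  have c: "carrier_simplex (affine_extension \<Delta> (\<lambda>v. v)) \<tau> = convex hull \<tau>" if "\<tau> \<in> \<Delta>" for \<tau>
    using affine_extension_image[OF ac that] by (simp add: carrier_simplex_def)
  obtain S where S: "S \<in> K" "\<sigma> \<subseteq> S" using r \<sigma> by blast
  have "A ` (convex hull \<sigma>) = convex hull (A ` \<sigma>)"
    by (rule A_hull[OF S(1) D(3,4)[OF \<sigma>] S(2)])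
  then show "\<exists>\<tau>\<in>\<Delta>. A ` carrier_simplex (affine_extension \<Delta> (\<lambda>v. v)) \<sigma> =
      carrier_simplex (affine_extension \<Delta> (\<lambda>v. v)) \<tau>"
    using A[OF \<sigma>] c \<sigma> by metis
  have "convex hull \<sigma> \<subseteq> S" using hull_in[OF S] .
  then show "carrier_simplex (affine_extension \<Delta> (\<lambda>v. v)) \<sigma> \<inter>
      A ` carrier_simplex (affine_extension \<Delta> (\<lambda>v. v)) \<sigma> = {}"
    using A_disjoint[OF S(1)] c[OF \<sigma>] by blast
qed

end

section \<open>Arbitrary antipodal triangulations, and the origin in a hull\<close>

text \<open>The definition only says that \<open>A\<close> maps carriers to carriers. Since a vertex
  lies in a carrier exactly when it belongs to the simplex, carriers determine vertex sets, and the
  action on carriers comes from an action on vertices.\<close>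

lemma antipodal_triangulation_simplex:
  assumes T: "antipodal_triangulation X A \<Delta> h" and free: "free_involution_on X A" and \<sigma>: "\<sigma> \<in> \<Delta>"
  shows "A ` \<sigma> \<in> \<Delta>" "A ` carrier_simplex h \<sigma> = carrier_simplex h (A ` \<sigma>)"
    "\<And>v. v \<in> \<sigma> \<Longrightarrow> v \<in> X"
proof -
  from T obtain g where ac: "abstract_complex \<Delta>" and hom: "homeomorphism (realization \<Delta>) X h g"
    and hv: "\<And>v. v \<in> \<Union>\<Delta> \<Longrightarrow> h (indicat_real {v}) = v"
    by (auto simp: antipodal_triangulation_def triangulation_of_def)
  note D = abstract_complexD[OF ac]
  have inj: "inj_on h (realization \<Delta>)" using hom unfolding homeomorphism_def by (metis inj_on_inverseI)
  have car: "carrier_simplex h \<tau> \<subseteq> X" if "\<tau> \<in> \<Delta>" for \<tau>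
    using hom that by (auto simp: homeomorphism_def carrier_simplex_def realization_def)
  have ind: "indicat_real {v} \<in> realization \<Delta>" if "v \<in> \<Union>\<Delta>" for v
    using D(6)[OF that] by (auto simp: realization_def bary_simplex_singleton intro!: bexI[of _ "{v}"])
  have mem: "v \<in> carrier_simplex h \<tau> \<longleftrightarrow> v \<in> \<tau>" if v: "v \<in> \<Union>\<Delta>" and \<tau>: "\<tau> \<in> \<Delta>" for v \<tau>
  proof
    assume "v \<in> \<tau>"
    then have "indicat_real {v} \<in> bary_simplex \<tau>" using indicator_in_bary_simplex[OF D(3)[OF \<tau>]] by blast
    then show "v \<in> carrier_simplex h \<tau>" using hv[OF v] unfolding carrier_simplex_def by (metis image_eqI)
  next
    assume "v \<in> carrier_simplex h \<tau>"
    then obtain t where t: "t \<in> bary_simplex \<tau>" "h t = h (indicat_real {v})"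
      using hv[OF v] by (auto simp: carrier_simplex_def)
    then have "t = indicat_real {v}" using inj_onD[OF inj] ind[OF v] \<tau> by (auto simp: realization_def)
    then show "v \<in> \<tau>" using t indicator_in_bary_simplex[OF D(3)[OF \<tau>]] by blast
  qed
  have im: "\<exists>\<tau>\<in>\<Delta>. A ` carrier_simplex h \<rho> = carrier_simplex h \<tau>" if "\<rho> \<in> \<Delta>" for \<rho>
    using T that by (auto simp: antipodal_triangulation_def)
  have vert: "v \<in> X" "A v \<in> \<Union>\<Delta>" "A (A v) = v" if v: "v \<in> \<Union>\<Delta>" for v
  proof -
    show "v \<in> X" using mem[OF v D(6)[OF v]] car[OF D(6)[OF v]] by blast
    then show "A (A v) = v" using free by (simp add: free_involution_on_def)
    \<comment> \<open>The carrier of \<open>{v}\<close> is a single point. Its image is again a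
      carrier, which contains some vertex, and that vertex can only be \<open>A v\<close>.\<close>
    obtain \<tau> where \<tau>: "\<tau> \<in> \<Delta>" "A ` carrier_simplex h {v} = carrier_simplex h \<tau>" using im[OF D(6)[OF v]] by blast
    obtain w where "w \<in> \<tau>" using D(4)[OF \<tau>(1)] by blast
    then have "w \<in> \<Union>\<Delta>" "w \<in> carrier_simplex h \<tau>" using mem \<tau>(1) by blast+
    moreover have "carrier_simplex h {v} = {v}"
      using hv[OF v] by (simp add: carrier_simplex_def bary_simplex_singleton)
    ultimately have "w = A v" using \<tau>(2) by auto
    then show "A v \<in> \<Union>\<Delta>" using \<open>w \<in> \<Union>\<Delta>\<close> by simp
  qed
  obtain \<tau> where \<tau>: "\<tau> \<in> \<Delta>" "A ` carrier_simplex h \<sigma> = carrier_simplex h \<tau>" using im[OF \<sigma>] by blast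
  have "\<tau> = A ` \<sigma>"
  proof
    show "A ` \<sigma> \<subseteq> \<tau>" using mem \<sigma> \<tau> vert(2) by blast
    show "\<tau> \<subseteq> A ` \<sigma>"
    proof
      fix w assume w: "w \<in> \<tau>"
      then have w\<Delta>: "w \<in> \<Union>\<Delta>" using \<tau>(1) by blast
      then have "w \<in> A ` carrier_simplex h \<sigma>" using mem \<tau> w by blast
      then obtain x where x: "x \<in> carrier_simplex h \<sigma>" "w = A x" by blast
      then have "x = A w" using free car[OF \<sigma>] by (auto simp: free_involution_on_def)
      then have "A w \<in> \<sigma>" using mem[OF vert(2)[OF w\<Delta>] \<sigma>] x by blast
      then show "w \<in> A ` \<sigma>" using vert(3)[OF w\<Delta>] by (metis image_eqI)
    qed
  qed
  then show "A ` \<sigma> \<in> \<Delta>" "A ` carrier_simplex h \<sigma> = carrier_simplex h (A ` \<sigma>)" using \<tau> by auto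
  show "\<And>v. v \<in> \<sigma> \<Longrightarrow> v \<in> X" using vert(1) \<sigma> by blast
qed

text \<open>Both \<open>y\<close> and \<open>- y\<close> lie in the hull, and 0 is their
  midpoint.\<close>

lemma convex_hull_antipodal_zero:
  fixes T :: "'a::real_vector set"
  assumes "y \<in> convex hull T" "y \<in> convex hull (uminus ` T)"
  shows "0 \<in> convex hull T"
proof -
  have "convex hull (uminus ` T) = uminus ` (convex hull T)"
    using convex_hull_linear_image[OF linear_uminus, of T] by simp
  then have "- y \<in> convex hull T" using assms(2) by auto
  then have "(1 / 2) *\<^sub>R y + (1 / 2) *\<^sub>R (- y) \<in> convex hull T"
    using assms(1) by (intro convexD[OF convex_convex_hull]) auto
  then show ?thesis by simp
qed

lemma coincidence_imp_zero_in_hull: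
  fixes p :: "int \<Rightarrow> 'b::real_normed_vector" and A :: "'a::topological_space \<Rightarrow> 'a"
  assumes BUT: "\<And>f :: 'a \<Rightarrow> 'b. continuous_on X f \<Longrightarrow> \<exists>x\<in>X. f (A x) = f x"
    and free: "free_involution_on X A"
    and T: "antipodal_triangulation X A \<Delta> h" and L: "antipodal_labeling A \<Delta> m L"
    and p: "\<And>k. k \<in> labels m \<Longrightarrow> p (- k) = - p k"
  shows "\<exists>\<sigma>\<in>\<Delta>. 0 \<in> convex hull (p ` L ` \<sigma>)"
proof -
  from T obtain g where ac: "abstract_complex \<Delta>" and hom: "homeomorphism (realization \<Delta>) X h g"
    by (auto simp: antipodal_triangulation_def triangulation_of_def)
  define f where "f x = affine_extension \<Delta> (p \<circ> L) (g x)" for x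
  have "continuous_on X f" unfolding f_def
    by (rule continuous_on_compose2[OF continuous_on_affine_extension[of UNIV]])
      (use hom in \<open>auto simp: homeomorphism_def\<close>)
  then obtain x where x: "x \<in> X" "f (A x) = f x" using BUT by blast
  have f_in: "f z \<in> convex hull (p ` L ` \<rho>)" if \<rho>: "\<rho> \<in> \<Delta>" "z \<in> carrier_simplex h \<rho>" for z \<rho>
  proof -
    obtain t where t: "t \<in> bary_simplex \<rho>" "z = h t" using \<rho> by (auto simp: carrier_simplex_def)
    then have "g z = t" using hom \<rho>(1) by (auto simp: homeomorphism_def realization_def)
    then show ?thesis using affine_extension_in_hull[OF ac \<rho>(1) t(1), of "p \<circ> L"]
      by (simp add: f_def image_comp)
  qed
  have "x \<in> h ` realization \<Delta>" using x(1) hom by (simp add: homeomorphism_def)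
  then obtain \<sigma> where \<sigma>: "\<sigma> \<in> \<Delta>" "x \<in> carrier_simplex h \<sigma>"
    by (auto simp: realization_def carrier_simplex_def)
  note A\<sigma> = antipodal_triangulation_simplex[OF T free \<sigma>(1)]
  \<comment> \<open>Nothing is known about the coordinates of \<open>A x\<close>, only which simplex
    carries it; membership in a hull needs no more.\<close>
  have "A x \<in> carrier_simplex h (A ` \<sigma>)" using A\<sigma>(2) \<sigma>(2) by blast
  then have "f x \<in> convex hull (p ` L ` A ` \<sigma>)" using f_in[OF A\<sigma>(1)] x(2) by metis
  moreover have "p (L (A v)) = - p (L v)" if "v \<in> \<sigma>" for v
  proof -
    have "v \<in> \<Union>\<Delta>" using that \<sigma>(1) by blast
    then have "L v \<in> labels m" "L (A v) = - L v" using L by (auto simp: antipodal_labeling_def)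
    then show ?thesis using p by simp
  qed
  then have "p ` L ` A ` \<sigma> = uminus ` p ` L ` \<sigma>" by (simp add: image_image)
  ultimately have "0 \<in> convex hull (p ` L ` \<sigma>)"
    using f_in[OF \<sigma>] convex_hull_antipodal_zero by metis
  then show ?thesis using \<sigma>(1) by blast
qed

section \<open>Points on the moment curve\<close>

text \<open>The point (t, t^2, ..., t^n) with t = \<open>\<bar>l\<bar>\<close>, multiplied by the
  sign of \<open>l\<close> so that the family is centrally symmetric; \<open>idx\<close> numbers the
  coordinates from 0. Exponents start at 1, so the first coordinate is \<open>l\<close> itself and
  the points are distinct, as (4) demands.\<close>

definition moment_point :: "('n \<Rightarrow> nat) \<Rightarrow> int \<Rightarrow> real ^ 'n::finite" where
  "moment_point idx l = (\<chi> i. real_of_int (sgn l) * real_of_int \<bar>l\<bar> ^ Suc (idx i))"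

lemma moment_point_uminus: "moment_point idx (- l) = - moment_point idx l"
  by (simp add: moment_point_def vec_eq_iff sgn_minus)

lemma inj_moment_point:
  fixes idx :: "'n::finite \<Rightarrow> nat"
  assumes "bij_betw idx UNIV {0..<CARD('n)}"
  shows "inj (moment_point idx)"
proof (rule injI)
  fix l l' assume eq: "moment_point idx l = moment_point idx l'"
  have "0 \<in> idx ` UNIV" using assms by (simp add: bij_betw_def)
  then obtain i where i: "idx i = 0" by auto
  have "moment_point idx k $ i = real_of_int k" for k
    by (simp add: moment_point_def i sgn_if)
  then show "l = l'" using eq by (metis of_int_eq_iff)
qed

text \<open>Weight the coordinates of the relation by the coefficients of \<open>q\<close> and add.
  The additional factor \<open>\<bar>l\<bar>\<close> reflects the exponents starting at 1 and, being
  positive for nonzero labels, does not disturb signs.\<close>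

lemma moment_point_relation:
  fixes idx :: "'n::finite \<Rightarrow> nat" and q :: "real poly"
  assumes idx: "bij_betw idx UNIV {0..<CARD('n)}"
    and zero: "(\<Sum>l\<in>M. c l *\<^sub>R moment_point idx l) = 0" and deg: "degree q < CARD('n)"
  shows "(\<Sum>l\<in>M. c l * real_of_int (sgn l) * real_of_int \<bar>l\<bar> * poly q (real_of_int \<bar>l\<bar>)) = 0"
proof -
  have pw: "(\<Sum>l\<in>M. c l * real_of_int (sgn l) * real_of_int \<bar>l\<bar> ^ Suc j) = 0" if "j < CARD('n)" for j
  proof -
    have "j \<in> idx ` UNIV" using idx that by (simp add: bij_betw_def)
    then obtain i where i: "idx i = j" by auto
    have "(\<Sum>l\<in>M. c l *\<^sub>R moment_point idx l) $ i = 0" using zero by simp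
    then show ?thesis by (simp add: sum_component moment_point_def i mult.assoc)
  qed
  have "(\<Sum>l\<in>M. c l * real_of_int (sgn l) * real_of_int \<bar>l\<bar> * poly q (real_of_int \<bar>l\<bar>)) =
      (\<Sum>l\<in>M. \<Sum>j\<le>degree q. coeff q j * (c l * real_of_int (sgn l) * real_of_int \<bar>l\<bar> ^ Suc j))"
    by (simp add: poly_altdef sum_distrib_left algebra_simps)
  also have "\<dots> = (\<Sum>j\<le>degree q. coeff q j * (\<Sum>l\<in>M. c l * real_of_int (sgn l) * real_of_int \<bar>l\<bar> ^ Suc j))"
    by (subst sum.swap) (simp only: sum_distrib_left)
  also have "\<dots> = 0" using pw deg by (intro sum.neutral) auto
  finally show ?thesis .
qed

text \<open>A polynomial of degree below \<open>CARD('n)\<close> with the signs of the labels would contradict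
  the linear relation between the moment points.\<close>

lemma zero_in_hull_moment_alternating:
  fixes idx :: "'n::finite \<Rightarrow> nat" and M :: "int set"
  assumes idx: "bij_betw idx UNIV {0..<CARD('n)}" and "finite M"
    and M: "\<And>l. l \<in> M \<Longrightarrow> l \<noteq> 0 \<and> - l \<notin> M"
    and zero: "0 \<in> convex hull (moment_point idx ` M)"
  shows "\<exists>k \<epsilon>. strict_mono_on {0..CARD('n)} k \<and> 1 \<le> k 0 \<and> (\<epsilon> = 1 \<or> \<epsilon> = -1) \<and>
    (\<forall>i\<le>CARD('n). \<epsilon> * ((-1) ^ i * k i) \<in> M)"
proof -
  have injp: "inj_on (moment_point idx) M" using inj_moment_point[OF idx] inj_on_subset by blast
  obtain u where u: "\<forall>x\<in>moment_point idx ` M. 0 \<le> u x" "sum u (moment_point idx ` M) = 1"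
    "(\<Sum>x\<in>moment_point idx ` M. u x *\<^sub>R x) = 0"
    using zero \<open>finite M\<close> by (auto simp: convex_hull_finite)
  define c where "c l = u (moment_point idx l)" for l
  have c: "\<And>l. l \<in> M \<Longrightarrow> 0 \<le> c l" "sum c M = 1" "(\<Sum>l\<in>M. c l *\<^sub>R moment_point idx l) = 0"
    using u by (auto simp: c_def sum.reindex[OF injp])
  define N where "N = (\<lambda>l. nat \<bar>l\<bar>) ` M"
  \<comment> \<open>The sign of the label with absolute value \<open>x\<close>; unambiguous, as
    \<open>M\<close> never contains both a label and its negative.\<close>
  define s :: "nat \<Rightarrow> real" where "s x = (if int x \<in> M then 1 else - 1)" for x
  have sgn_s: "s (nat \<bar>l\<bar>) = real_of_int (sgn l)" if "l \<in> M" for l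
    using M[OF that] that by (auto simp: s_def sgn_if)
  have "M \<noteq> {}" using c(2) by auto
  then have "finite N" "N \<noteq> {}" using \<open>finite M\<close> by (auto simp: N_def)
  moreover have "s x = 1 \<or> s x = -1" for x by (simp add: s_def)
  ultimately obtain d k and q :: "real poly" where k: "strict_mono_on {0..d} k" "k ` {0..d} \<subseteq> N"
     "\<forall>i\<le>d. s (k i) = (-1) ^ i * s (k 0)" "degree q \<le> d" "\<forall>x\<in>N. poly q (real x) * s x > 0"
    using alternating_or_polynomial[of N s] by blast
  have "CARD('n) \<le> d"
  proof (rule ccontr)
    assume "\<not> CARD('n) \<le> d"
    then have "degree q < CARD('n)" using k(4) by linarith
    define w where "w l = real_of_int (sgn l) * real_of_int \<bar>l\<bar> * poly q (real_of_int \<bar>l\<bar>)" for l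
    have 0: "(\<Sum>l\<in>M. c l * w l) = 0"
      using moment_point_relation[OF idx c(3) \<open>degree q < CARD('n)\<close>] by (simp add: w_def mult.assoc)
    have pos: "w l > 0" if "l \<in> M" for l
    proof -
      have "poly q (real (nat \<bar>l\<bar>)) * s (nat \<bar>l\<bar>) > 0" using k(5) that by (simp add: N_def)
      moreover have "real_of_int \<bar>l\<bar> > 0" using M[OF that] by simp
      ultimately have "real_of_int \<bar>l\<bar> * (poly q (real (nat \<bar>l\<bar>)) * s (nat \<bar>l\<bar>)) > 0" by simp
      then show ?thesis by (simp add: w_def sgn_s[OF that] algebra_simps)
    qed
    have "\<forall>l\<in>M. c l * w l = 0"
      using 0 sum_nonneg_eq_0_iff[OF \<open>finite M\<close>, of "\<lambda>l. c l * w l"] c(1) pos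
      by (simp add: less_imp_le)
    then have "c l = 0" if "l \<in> M" for l
      using pos that by (metis less_irrefl mult_eq_0_iff)
    then show False using c(2) by simp
  qed
  \<comment> \<open>The sign of the first label in the alternating sequence. The linear relation
    cannot decide it, so the conclusion is only up to a global sign.\<close>
  define \<epsilon> :: int where "\<epsilon> = (if int (k 0) \<in> M then 1 else - 1)"
  have \<epsilon>: "real_of_int \<epsilon> = s (k 0)" by (simp add: \<epsilon>_def s_def)
  have "\<epsilon> * ((-1) ^ i * int (k i)) \<in> M" if "i \<le> CARD('n)" for i
  proof -
    have i: "i \<le> d" using that \<open>CARD('n) \<le> d\<close> by linarith
    then obtain l where l: "l \<in> M" "k i = nat \<bar>l\<bar>" using k(2) by (force simp: N_def)
    have "real_of_int (sgn l) = (-1) ^ i * real_of_int \<epsilon>" using k(3) i sgn_s[OF l(1)] l(2) \<epsilon> by metis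
    then have "real_of_int (sgn l) = real_of_int ((-1) ^ i * \<epsilon>)" by simp
    then have "sgn l = (-1) ^ i * \<epsilon>" by (simp only: of_int_eq_iff)
    then have "\<epsilon> * ((-1) ^ i * int (k i)) = sgn l * \<bar>l\<bar>" using l(2) by simp
    also have "\<dots> = l" by (simp add: sgn_mult_abs)
    finally show ?thesis using l(1) by simp
  qed
  moreover have "strict_mono_on {0..CARD('n)} (\<lambda>i. int (k i))"
    using k(1) \<open>CARD('n) \<le> d\<close> by (auto simp: strict_mono_on_def)
  moreover have "1 \<le> int (k 0)"
  proof -
    have "k 0 \<in> N" using k(2) by auto
    then show ?thesis using M by (force simp: N_def)
  qed
  ultimately show ?thesis by (intro exI[of _ "\<lambda>i. int (k i)"] exI[of _ \<epsilon>]) (auto simp: \<epsilon>_def)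
qed

text \<open>If the alternation starts with the wrong sign, the antipodal simplex carries the negated
  labels and has the right pattern. One vertex per label then spans a face with exactly the required
  labels.\<close>

lemma alternating_simplex:
  fixes A :: "'a::topological_space \<Rightarrow> 'a" and idx :: "'n::finite \<Rightarrow> nat"
  assumes idx: "bij_betw idx UNIV {0..<CARD('n)}"
    and free: "free_involution_on X A"
    and T: "antipodal_triangulation X A \<Delta> h" and L: "antipodal_labeling A \<Delta> m L"
    and no: "\<not> (\<exists>u v. complementary_edge \<Delta> L u v)"
    and \<sigma>: "\<sigma> \<in> \<Delta>" "0 \<in> convex hull (moment_point idx ` L ` \<sigma>)"
  shows "\<exists>\<sigma>\<in>\<Delta>. card \<sigma> = CARD('n) + 1 \<and>
    (\<exists>k :: nat \<Rightarrow> int. 1 \<le> k 0 \<and> strict_mono_on {0..CARD('n)} k \<and> k CARD('n) \<le> int m \<and>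
       L ` \<sigma> = (\<lambda>i. (-1) ^ i * k i) ` {0..CARD('n)})"
proof -
  let ?n = "CARD('n)"
  have ac: "abstract_complex \<Delta>" using T by (simp add: antipodal_triangulation_def triangulation_of_def)
  note D = abstract_complexD[OF ac]
  have Lv: "L v \<in> labels m" "L (A v) = - L v" if "v \<in> \<rho>" "\<rho> \<in> \<Delta>" for v \<rho>
    using L that by (auto simp: antipodal_labeling_def)
  \<comment> \<open>Any two vertices of a simplex span an edge, so opposite labels inside one
    simplex would give a complementary edge.\<close>
  have M: "l \<noteq> 0 \<and> - l \<notin> L ` \<sigma>" if "l \<in> L ` \<sigma>" for l
  proof -
    obtain v where v: "v \<in> \<sigma>" "L v = l" using \<open>l \<in> L ` \<sigma>\<close> by blast
    have l0: "l \<noteq> 0" using Lv(1)[OF v(1) \<sigma>(1)] v(2) by (auto simp: labels_def)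
    moreover have "- l \<notin> L ` \<sigma>"
    proof
      assume "- l \<in> L ` \<sigma>"
      then obtain w where w: "w \<in> \<sigma>" "- l = L w" by blast
      then have "v \<noteq> w" using v l0 by auto
      moreover have "{v, w} \<in> \<Delta>" using D(5)[OF \<sigma>(1), of "{v, w}"] v w by blast
      ultimately show False using no v w unfolding complementary_edge_def by force
    qed
    ultimately show ?thesis ..
  qed
  have "finite (L ` \<sigma>)" using D(3)[OF \<sigma>(1)] by simp
  from zero_in_hull_moment_alternating[OF idx this M \<sigma>(2)]
  obtain k \<epsilon> where k: "strict_mono_on {0..?n} k" "1 \<le> k 0" "\<epsilon> = 1 \<or> \<epsilon> = -1"
    "\<forall>i\<le>?n. \<epsilon> * ((-1) ^ i * k i) \<in> L ` \<sigma>" by blast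
  have "\<exists>\<rho>\<in>\<Delta>. \<forall>i\<le>?n. (-1) ^ i * k i \<in> L ` \<rho>"
  proof (cases "\<epsilon> = 1")
    case True
    then show ?thesis using k(4) \<sigma>(1) by auto
  next
    case False
    then have e: "\<epsilon> = -1" using k(3) by blast
    have "L ` A ` \<sigma> = uminus ` L ` \<sigma>" using Lv(2)[OF _ \<sigma>(1)] by (simp add: image_image)
    moreover have "(-1) ^ i * k i \<in> uminus ` L ` \<sigma>" if "i \<le> ?n" for i
      using k(4)[rule_format, OF that] unfolding e by (intro image_eqI[of _ _ "-1 * ((-1) ^ i * k i)"]) auto
    ultimately show ?thesis using antipodal_triangulation_simplex(1)[OF T free \<sigma>(1)] by metis
  qed
  then obtain \<rho> where \<rho>: "\<rho> \<in> \<Delta>" "\<forall>i\<le>?n. \<exists>v\<in>\<rho>. L v = (-1) ^ i * k i"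
    by (metis imageE)
  \<comment> \<open>The simplex \<open>\<rho>\<close> may carry further labels or repeat some; the
    chosen vertices cut out the face of the right size.\<close>
  then obtain v where v: "\<And>i. i \<le> ?n \<Longrightarrow> v i \<in> \<rho> \<and> L (v i) = (-1) ^ i * k i" by metis
  have kpos: "1 \<le> k i" if "i \<le> ?n" for i
    using k(1,2) that strict_mono_onD[OF k(1), of 0 i] by (cases "i = 0") auto
  have "inj_on v {0..?n}"
  proof (rule inj_onI)
    fix i j assume ij: "i \<in> {0..?n}" "j \<in> {0..?n}" "v i = v j"
    then have "(-1) ^ i * k i = (-1) ^ j * k j" using v[of i] v[of j] by auto
    then have "\<bar>(-1) ^ i * k i\<bar> = \<bar>(-1) ^ j * k j\<bar>" by simp
    then have "k i = k j" using kpos[of i] kpos[of j] ij by (simp add: abs_mult power_abs)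
    then show "i = j" using strict_mono_on_imp_inj_on[OF k(1)] ij by (simp add: inj_on_eq_iff)
  qed
  then have "card (v ` {0..?n}) = ?n + 1" by (simp add: card_image)
  moreover have "v ` {0..?n} \<in> \<Delta>" using v by (intro D(5)[OF \<rho>(1)]) auto
  moreover have "L ` v ` {0..?n} = (\<lambda>i. (-1) ^ i * k i) ` {0..?n}"
    using v by (auto simp: image_image)
  moreover have "k ?n \<le> int m"
  proof -
    have "\<bar>L (v ?n)\<bar> \<le> int m" using Lv(1)[OF _ \<rho>(1), of "v ?n"] v[of ?n] by (simp add: labels_def)
    also have "L (v ?n) = (-1) ^ ?n * k ?n" using v[of ?n] by simp
    finally show ?thesis using kpos[of ?n] by (simp add: abs_mult power_abs)
  qed
  ultimately show ?thesis using k(1,2) by blast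
qed

section \<open>From complementary edges to coincidences\<close>

text \<open>Continuity is not assumed: being affine on each simplex, \<open>A\<close> agrees with
  the affine extension of its values at the vertices.\<close>

lemma (in free_simplicial_involution) continuous_on_A: "continuous_on (\<Union>K) A"
proof -
  let ?V = "vertex_complex K"
  have ac: "abstract_complex ?V"
    using geometric_vertex_complex[OF complex] by (simp add: geometric_complex_def)
  obtain g where hom: "homeomorphism (realization ?V) (\<Union>K) (affine_extension ?V (\<lambda>v. v)) g"
    using triangulation_of_geometric_complex[OF geometric_vertex_complex[OF complex]]
    unfolding triangulation_of_def polyhedron_of_vertex_complex[OF complex] by blast
  have "affine_extension ?V A (g x) = A x" if "x \<in> \<Union>K" for x
  proof -
    have gx: "g x \<in> realization ?V" "affine_extension ?V (\<lambda>v. v) (g x) = x"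
      using hom that unfolding homeomorphism_def by blast+
    then obtain \<sigma> where \<sigma>: "\<sigma> \<in> ?V" "g x \<in> bary_simplex \<sigma>" by (auto simp: realization_def)
    obtain S where S: "S \<in> K" "\<sigma> \<subseteq> S"
      using invariant_vertex_complex \<sigma>(1) by (auto simp: invariant_triangulation_def)
    have "A (\<Sum>v\<in>\<sigma>. g x v *\<^sub>R v) = (\<Sum>v\<in>\<sigma>. g x v *\<^sub>R A v)"
      using abstract_complexD(3,4)[OF ac \<sigma>(1)] \<sigma>(2) S(2)
      by (intro A_combination[OF S(1)]) (auto simp: bary_simplex_def)
    then show ?thesis using affine_extension_simplex[OF ac \<sigma>, of A] gx(2)
        affine_extension_simplex[OF ac \<sigma>, of "\<lambda>v. v"] by simp
  qed
  moreover have "continuous_on (\<Union>K) (\<lambda>x. affine_extension ?V A (g x))"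
    by (rule continuous_on_compose2[OF continuous_on_affine_extension[of UNIV]])
      (use hom in \<open>auto simp: homeomorphism_def\<close>)
  ultimately show ?thesis by (rule continuous_on_eq[rotated])
qed

lemma (in free_simplicial_involution) complementary_edge_imp_coincidence:
  fixes f :: "'a \<Rightarrow> real ^ 'n"
  assumes S2: "\<And>\<Delta> h L. antipodal_triangulation (\<Union>K) A \<Delta> h \<Longrightarrow> antipodal_labeling A \<Delta> CARD('n) L \<Longrightarrow>
      \<exists>u v. complementary_edge \<Delta> L u v"
    and f: "continuous_on (\<Union>K) f"
  shows "\<exists>x\<in>\<Union>K. f (A x) = f x"
proof (rule ccontr)
  assume no: "\<not> (\<exists>x\<in>\<Union>K. f (A x) = f x)"
  let ?X = "\<Union>K"
  have compact: "compact ?X"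
    using complex simplex_in compact_simplex unfolding simplicial_complex_def
    by (intro compact_Union) blast+
  define g where "g x = f x - f (A x)" for x
  have "continuous_on ?X g" unfolding g_def
    by (intro continuous_intros f continuous_on_compose2[OF f continuous_on_A]) (use A_in in blast)
  have gA: "g (A x) = - g x" if "x \<in> ?X" for x using A_A[OF that] by (simp add: g_def)
  have "closed (g ` ?X)" using compact_continuous_image[OF \<open>continuous_on ?X g\<close> compact] compact_imp_closed by blast
  moreover have "0 \<notin> g ` ?X" using no by (force simp: g_def)
  ultimately obtain d where d: "d > 0" "\<And>x. x \<in> ?X \<Longrightarrow> d \<le> norm (g x)"
    using separate_point_closed[of "g ` ?X" 0] by auto
  \<comment> \<open>The norm is at most the sum of the absolute coordinates, so a norm of at least
    \<open>d\<close> forces some coordinate to be at least \<open>d / n\<close> in absolute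
    value.\<close>
  define \<delta> where "\<delta> = d / real CARD('n)"
  have \<delta>: "\<delta> > 0" using d(1) by (simp add: \<delta>_def)
  have big: "\<exists>i. \<delta> \<le> \<bar>g x $ i\<bar>" if "x \<in> ?X" for x
  proof (rule ccontr)
    assume "\<not> (\<exists>i. \<delta> \<le> \<bar>g x $ i\<bar>)"
    then have "(\<Sum>i\<in>UNIV. \<bar>g x $ i\<bar>) < (\<Sum>i\<in>(UNIV::'n set). \<delta>)"
      by (intro sum_strict_mono) (auto simp: not_le)
    also have "\<dots> = d" by (simp add: \<delta>_def)
    finally show False using norm_le_l1_cart[of "g x"] d(2)[OF that] by linarith
  qed
  have "uniformly_continuous_on ?X g"
    by (rule compact_uniformly_continuous[OF \<open>continuous_on ?X g\<close> compact])
  then obtain e where e: "e > 0" "\<And>x y. x \<in> ?X \<Longrightarrow> y \<in> ?X \<Longrightarrow> dist y x < e \<Longrightarrow> dist (g y) (g x) < \<delta>"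
    using \<delta> unfolding uniformly_continuous_on_def by metis
  obtain \<Delta> where \<Delta>: "invariant_triangulation \<Delta>"
    and fine: "\<And>\<sigma> u v. \<sigma> \<in> \<Delta> \<Longrightarrow> u \<in> \<sigma> \<Longrightarrow> v \<in> \<sigma> \<Longrightarrow> dist u v < e"
    using invariant_triangulation_fine[OF e(1)] by blast
  have T: "antipodal_triangulation ?X A \<Delta> (affine_extension \<Delta> (\<lambda>v. v))"
    by (rule antipodal_triangulation_invariant[OF \<Delta>])
  obtain idx :: "'n \<Rightarrow> nat" where idx: "bij_betw idx UNIV {0..<CARD('n)}"
    using ex_bij_betw_finite_nat[of "UNIV::'n set"] by auto
  have idx_less: "idx i < CARD('n)" for i using idx by (auto simp: bij_betw_def)
  \<comment> \<open>The choice depends only on absolute values of coordinates, so \<open>x\<close>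
    and \<open>A x\<close> receive the same index; this makes the labeling antipodal.\<close>
  define co where "co x = (SOME i. \<delta> \<le> \<bar>g x $ i\<bar>)" for x
  have co: "\<delta> \<le> \<bar>g x $ co x\<bar>" if "x \<in> ?X" for x unfolding co_def by (rule someI_ex[OF big[OF that]])
  define s :: "'a \<Rightarrow> int" where "s x = (if g x $ co x > 0 then 1 else - 1)" for x
  \<comment> \<open>The \<open>+ 1\<close> shifts the indices 0, ..., n - 1 to the labels 1, ...,
    n.\<close>
  define L where "L x = s x * (int (idx (co x)) + 1)" for x
  have vX: "v \<in> ?X" if "v \<in> \<Union>\<Delta>" for v using \<Delta> that unfolding invariant_triangulation_def by blast
  have absL: "\<bar>L x\<bar> = int (idx (co x)) + 1" for x by (simp add: L_def s_def)
  have "antipodal_labeling A \<Delta> CARD('n) L"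
    unfolding antipodal_labeling_def
  proof (intro ballI conjI)
    fix v assume v: "v \<in> \<Union>\<Delta>"
    show "L v \<in> labels CARD('n)" using idx_less[of "co v"] by (auto simp: labels_def absL)
    have "co (A v) = co v" unfolding co_def using gA[OF vX[OF v]] by simp
    then show "L (A v) = - L v" using gA[OF vX[OF v]] co[OF vX[OF v]] \<delta> by (auto simp: L_def s_def)
  qed
  then obtain u v where uv: "{u, v} \<in> \<Delta>" "L u = - L v"
    using S2[OF T] unfolding complementary_edge_def by blast
  then have X: "u \<in> ?X" "v \<in> ?X" using vX by blast+
  have "\<bar>L u\<bar> = \<bar>L v\<bar>" using uv(2) by simp
  then have "idx (co u) = idx (co v)" by (simp add: absL)
  then have c: "co u = co v" using idx by (simp add: bij_betw_def inj_eq)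
  then have "s u = - s v" using uv(2) by (simp add: L_def) (simp flip: mult_minus_left)
  \<comment> \<open>At the common index the two values have opposite signs and absolute value at
    least \<open>\<delta>\<close>, so they differ by \<open>2 * \<delta>\<close>, whereas adjacent
    vertices allow less than \<open>\<delta>\<close>.\<close>
  then have "2 * \<delta> \<le> \<bar>(g u - g v) $ co v\<bar>"
    using co[OF X(1)] co[OF X(2)] \<delta> c by (auto simp: s_def split: if_splits)
  also have "\<dots> \<le> norm (g u - g v)" by (rule component_le_norm_cart)
  also have "\<dots> < \<delta>" using e(2)[OF X(2,1)] fine[OF uv(1)] by (simp add: dist_norm)
  finally show False using \<delta> by simp
qed

theorem theorem2p2:
  fixes K :: "'a::euclidean_space set set" and A :: "'a \<Rightarrow> 'a"
  assumes "simplicial_complex K"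
    and "simplicial_self_map K A"
    and "free_involution_on (\<Union>K) A"
  defines "S1 \<equiv> \<forall>f :: 'a \<Rightarrow> real ^ 'n. continuous_on (\<Union>K) f \<longrightarrow> (\<exists>x\<in>\<Union>K. f (A x) = f x)"
    and "S2 \<equiv> \<forall>\<Delta> h L. antipodal_triangulation (\<Union>K) A \<Delta> h \<and> antipodal_labeling A \<Delta> CARD('n) L \<longrightarrow>
           (\<exists>u v. complementary_edge \<Delta> L u v)"
    and "S3 \<equiv> \<forall>m \<Delta> h L. 1 \<le> m \<and> antipodal_triangulation (\<Union>K) A \<Delta> h \<and>
           antipodal_labeling A \<Delta> m L \<and> \<not> (\<exists>u v. complementary_edge \<Delta> L u v) \<longrightarrow>
           (\<exists>\<sigma>\<in>\<Delta>. card \<sigma> = CARD('n) + 1 \<and>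
             (\<exists>k :: nat \<Rightarrow> int. 1 \<le> k 0 \<and> strict_mono_on {0..CARD('n)} k \<and> k CARD('n) \<le> int m \<and>
                L ` \<sigma> = (\<lambda>i. (-1) ^ i * k i) ` {0..CARD('n)}))"
    and "S4 \<equiv> \<forall>m (p :: int \<Rightarrow> real ^ 'n) \<Delta> h L. 1 \<le> m \<and>
           inj_on p (labels m) \<and> (\<forall>k\<in>labels m. p (- k) = - p k) \<and>
           antipodal_triangulation (\<Union>K) A \<Delta> h \<and> antipodal_labeling A \<Delta> m L \<longrightarrow>
           (\<exists>\<sigma>\<in>\<Delta>. 0 \<in> convex hull (p ` L ` \<sigma>))"
  shows "(S1 \<longleftrightarrow> S2) \<and> (S1 \<longleftrightarrow> S3) \<and> (S1 \<longleftrightarrow> S4)"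
proof -
  interpret free_simplicial_involution K A by unfold_locales (rule assms)+
  have "S1 \<Longrightarrow> S4"
    unfolding S1_def S4_def using coincidence_imp_zero_in_hull[OF _ free] by blast
  moreover have "S3" if "S4"
  proof -
    obtain idx :: "'n \<Rightarrow> nat" where idx: "bij_betw idx UNIV {0..<CARD('n)}"
      using ex_bij_betw_finite_nat[of "UNIV::'n set"] by auto
    show ?thesis
      unfolding S3_def
    proof (intro allI impI, elim conjE)
      fix m \<Delta> h L
      assume H: "1 \<le> m" "antipodal_triangulation (\<Union>K) A \<Delta> h" "antipodal_labeling A \<Delta> m L"
        and no: "\<not> (\<exists>u v. complementary_edge \<Delta> L u v)"
      have "inj_on (moment_point idx) (labels m)" using inj_moment_point[OF idx] inj_on_subset by blast
      then obtain \<sigma> where "\<sigma> \<in> \<Delta>" "0 \<in> convex hull (moment_point idx ` L ` \<sigma>)"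
        using \<open>S4\<close> H moment_point_uminus unfolding S4_def by blast
      then show "\<exists>\<sigma>\<in>\<Delta>. card \<sigma> = CARD('n) + 1 \<and>
        (\<exists>k :: nat \<Rightarrow> int. 1 \<le> k 0 \<and> strict_mono_on {0..CARD('n)} k \<and> k CARD('n) \<le> int m \<and>
           L ` \<sigma> = (\<lambda>i. (-1) ^ i * k i) ` {0..CARD('n)})"
        by (rule alternating_simplex[OF idx free H(2,3) no])
    qed
  qed
  moreover have "S2" if "S3"
    unfolding S2_def
  proof (intro allI impI, elim conjE, rule ccontr)
    fix \<Delta> h L
    assume H: "antipodal_triangulation (\<Union>K) A \<Delta> h" "antipodal_labeling A \<Delta> CARD('n) L"
      and no: "\<not> (\<exists>u v. complementary_edge \<Delta> L u v)"
    \<comment> \<open>(3) is used with \<open>m\<close> equal to the dimension, where its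
      requirement \<open>1 \<le> m\<close> has to be met.\<close>
    have "1 \<le> CARD('n)" by (simp add: Suc_le_eq)
    with \<open>S3\<close> H no obtain k :: "nat \<Rightarrow> int" where k: "1 \<le> k 0" "strict_mono_on {0..CARD('n)} k"
      "k CARD('n) \<le> int CARD('n)" unfolding S3_def by blast
    \<comment> \<open>A strictly increasing integer sequence starting at 1 or more exceeds its
      index, so the last of the n + 1 labels is too large.\<close>
    have "int i + 1 \<le> k i" if "i \<le> CARD('n)" for i
      using that
    proof (induction i)
      case (Suc i)
      then show ?case using strict_mono_onD[OF k(2), of i "Suc i"] by auto
    qed (use k in simp)
    from this[of "CARD('n)"] show False using k(3) by simp
  qed
  moreover have "S1" if "S2"
    unfolding S1_def
  proof (intro allI impI)
    fix f :: "'a \<Rightarrow> real ^ 'n" assume "continuous_on (\<Union>K) f"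
    then show "\<exists>x\<in>\<Union>K. f (A x) = f x"
      using \<open>S2\<close> unfolding S2_def by (intro complementary_edge_imp_coincidence) blast+
  qed
  ultimately show ?thesis by blast
qed

end
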